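(* For each $I\in\mathcal I_\lambda$, there is a unique class $c\in K_{(\mathbb C^\times)^n}(\mathcal F_\lambda)$ satisfying (1) $c|_{x_I}=\prod_{k<l}\prod_{a\in I_k}\prod_{b\in I_l,\,b>a}(1-z_b/z_a)$ and (2) $c|_{x_J}$ is $J$-small (in the sense below) for every $J\ne I$. Moreover this class is the class $[W_I(\cdot,z,0)]$ whose restriction to $x_J$ equals $W_I(z_J,z,0)$ for every $J\in\mathcal I_\lambda$.
   Context: $\mathcal I_\lambda$ = ordered partitions $I=(I_1,\dots,I_N)$ of $\{1..n\}$ with $|I_k|=\lambda_k$. $K_{(\mathbb C^\times)^n}(\mathcal F_\lambda)=\mathbb C[\Gamma^{\pm1}]^{S_\lambda}\otimes\mathbb C[z^{\pm1}]/\langle f(\Gamma)=f(z),f\in\mathbb C[z^{\pm1}]^{S_n}\rangle$ with $\Gamma=(\gamma_{k,a})_{a\le\lambda_k}$ and $S_\lambda$ permuting variables with equal first index; restriction to $x_J$ is the substitution $\{\gamma_{k,1},\dots,\gamma_{k,\lambda_k}\}\mapsto\{z_a:a\in J_k\}$, and the family of restrictions is injective. For a Laurent polynomial $f$ in $z$, $N(f)$ = Newton polytope; $\phi_J:\mathbb R^n\to\mathbb R$ linear with $\phi_J(\epsilon_a)=k$ for $a\in J_k$. Let $m_J$ be defined by $\phi_J(N(\prod_{k<l}\prod_{a\in J_k}\prod_{b\in J_l,b>a}(1-z_b/z_a)))=[0,m_J]$. In this statement, $f$ is $J$-small if $\phi_J(N(f))\subset[0,m_J-1]$. Weight function: $\lambda^{(k)}=\lambda_1+\dots+\lambda_k$,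 $I_1\cup\dots\cup I_k=\{i^{(k)}_1<\dots\}$, $t^{(N)}_a=z_a$, $U_I=\prod_{k=1}^{N-1}\prod_{a=1}^{\lambda^{(k)}}\Big(\prod_{c:\,i^{(k+1)}_c<i^{(k)}_a}(1-ht^{(k+1)}_c/t^{(k)}_a)\prod_{c:\,i^{(k+1)}_c>i^{(k)}_a}(1-t^{(k+1)}_c/t^{(k)}_a)\prod_{b>a}\frac{1-ht^{(k)}_b/t^{(k)}_a}{1-t^{(k)}_b/t^{(k)}_a}\Big)$, $W_I=(1-h)^{\sum_{k<N}\lambda^{(k)}}\mathrm{Sym}_{t^{(1)}}\cdots\mathrm{Sym}_{t^{(N-1)}}U_I$; $W_I(z_J,z,0)$ = substitution $t^{(k)}_a=z_{j^{(k)}_a}$ (with $J_1\cup\dots\cup J_k=\{j^{(k)}_1<\dots\}$) and $h=0$. *)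

theory Defs
  imports "HOL-Library.Poly_Mapping" "HOL-Combinatorics.Permutations" Complex_Main
begin

(* Variables: G k a = gamma_{k+1,a+1} (0-based), Z a = z_a (a in {1..n}) *)
datatype var = G nat nat | Z nat

type_synonym lpoly = "(var \<Rightarrow>\<^sub>0 int) \<Rightarrow>\<^sub>0 complex"

definition zv :: "nat \<Rightarrow> lpoly" where
  "zv a = Poly_Mapping.single (Poly_Mapping.single (Z a) 1) 1"
definition zinv :: "nat \<Rightarrow> lpoly" where
  "zinv a = Poly_Mapping.single (Poly_Mapping.single (Z a) (-1)) 1"

definition vars :: "lpoly \<Rightarrow> var set" where
  "vars f = (\<Union>e\<in>Poly_Mapping.keys f. Poly_Mapping.keys (e :: var \<Rightarrow>\<^sub>0 int))"

definition rename_exp :: "(var \<Rightarrow> var) \<Rightarrow> (var \<Rightarrow>\<^sub>0 int) \<Rightarrow> (var \<Rightarrow>\<^sub>0 int)" where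
  "rename_exp \<rho> e = (\<Sum>v\<in>Poly_Mapping.keys e. Poly_Mapping.single (\<rho> v) (Poly_Mapping.lookup e v))"
definition rename :: "(var \<Rightarrow> var) \<Rightarrow> lpoly \<Rightarrow> lpoly" where
  "rename \<rho> f = (\<Sum>e\<in>Poly_Mapping.keys f. Poly_Mapping.single (rename_exp \<rho> e) (Poly_Mapping.lookup f e))"

definition evalp :: "(var \<Rightarrow> complex) \<Rightarrow> lpoly \<Rightarrow> complex" where
  "evalp x f = (\<Sum>e\<in>Poly_Mapping.keys f. Poly_Mapping.lookup f e * (\<Prod>v\<in>Poly_Mapping.keys e. x v powi Poly_Mapping.lookup e v))"

definition Ilam :: "nat list \<Rightarrow> nat \<Rightarrow> nat set list set" where
  "Ilam lam n = {I. length I = length lam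
      \<and> (\<forall>k<length lam. I!k \<subseteq> {1..n} \<and> card (I!k) = lam!k)
      \<and> (\<forall>k l. k < l \<and> l < length lam \<longrightarrow> I!k \<inter> I!l = {})
      \<and> \<Union> (set I) = {1..n}}"

definition symGZ :: "nat list \<Rightarrow> nat \<Rightarrow> lpoly \<Rightarrow> bool" where
  "symGZ lam n F \<longleftrightarrow>
     vars F \<subseteq> {G k a | k a. k < length lam \<and> a < lam!k} \<union> {Z a | a. a \<in> {1..n}}
   \<and> (\<forall>k<length lam. \<forall>\<sigma>. \<sigma> permutes {..<lam!k} \<longrightarrow>
        rename (\<lambda>v. case v of G l a \<Rightarrow> (if l = k then G l (\<sigma> a) else G l a) | Z a \<Rightarrow> Z a) F = F)"

(* restriction to the fixed point x_J: {gamma_{k,1..lambda_k}} := {z_a : a in J_k} *)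
definition restr :: "nat set list \<Rightarrow> lpoly \<Rightarrow> lpoly" where
  "restr J F = rename (\<lambda>v. case v of G k a \<Rightarrow> Z (sorted_list_of_set (J!k) ! a) | Z a \<Rightarrow> Z a) F"

(* K_T(F_lambda), identified (via injectivity of restrictions) with the set of
   families of restrictions (J \<mapsto> c|_{x_J}), extended by 0 outside I_lambda *)
definition Kclass :: "nat list \<Rightarrow> nat \<Rightarrow> (nat set list \<Rightarrow> lpoly) set" where
  "Kclass lam n = {c. \<exists>F. symGZ lam n F
      \<and> (\<forall>J. c J = (if J \<in> Ilam lam n then restr J F else 0))}"

definition Pdiag :: "nat set list \<Rightarrow> lpoly" where
  "Pdiag I = (\<Prod>k<length I. \<Prod>l\<in>{k<..<length I}. \<Prod>a\<in>I!k. \<Prod>b\<in>{b\<in>I!l. b > a}.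
               (1 - zv b * zinv a))"

definition newton :: "lpoly \<Rightarrow> (nat \<Rightarrow> real) set" where
  "newton f = {x. \<exists>u. (\<forall>e\<in>Poly_Mapping.keys f. u e \<ge> 0) \<and> (\<Sum>e\<in>Poly_Mapping.keys f. u e) = 1
        \<and> x = (\<lambda>a. \<Sum>e\<in>Poly_Mapping.keys f. u e * real_of_int (Poly_Mapping.lookup e (Z a)))}"

(* phi_J(epsilon_a) = k for a in J_k (blocks numbered 1..N) *)
definition phi :: "nat set list \<Rightarrow> (nat \<Rightarrow> real) \<Rightarrow> real" where
  "phi J x = (\<Sum>k<length J. real (Suc k) * (\<Sum>a\<in>J!k. x a))"

definition mJ :: "nat set list \<Rightarrow> real" where
  "mJ J = Sup (phi J ` newton (Pdiag J))"

definition Jsmall :: "nat set list \<Rightarrow> lpoly \<Rightarrow> bool" where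
  "Jsmall J f \<longleftrightarrow> phi J ` newton f \<subseteq> {0 .. mJ J - 1}"

definition lev :: "nat list \<Rightarrow> nat \<Rightarrow> nat" where
  "lev lam k = sum_list (take k lam)"

(* idx I k a = i^{(k)}_{a+1}, the (a+1)-th smallest element of I_1 \<union> ... \<union> I_k *)
definition idx :: "nat set list \<Rightarrow> nat \<Rightarrow> nat \<Rightarrow> nat" where
  "idx I k a = sorted_list_of_set (\<Union> (set (take k I))) ! a"

(* U_I with t k a = t^{(k)}_{a+1} *)
definition Uval :: "nat list \<Rightarrow> nat set list \<Rightarrow> complex \<Rightarrow> (nat \<Rightarrow> nat \<Rightarrow> complex) \<Rightarrow> complex" where
  "Uval lam I h t = (\<Prod>k\<in>{1..<length lam}. \<Prod>a<lev lam k.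
     (\<Prod>c\<in>{c. c < lev lam (Suc k) \<and> idx I (Suc k) c < idx I k a}. 1 - h * t (Suc k) c / t k a)
   * (\<Prod>c\<in>{c. c < lev lam (Suc k) \<and> idx I (Suc k) c > idx I k a}. 1 - t (Suc k) c / t k a)
   * (\<Prod>b\<in>{a<..<lev lam k}. (1 - h * t k b / t k a) / (1 - t k b / t k a)))"

definition symperms :: "nat list \<Rightarrow> (nat \<Rightarrow> nat \<Rightarrow> nat) set" where
  "symperms lam = {\<sigma>. \<forall>k. (k \<in> {1..<length lam} \<longrightarrow> \<sigma> k permutes {..<lev lam k})
                        \<and> (k \<notin> {1..<length lam} \<longrightarrow> \<sigma> k = id)}"

(* value of W_I(z_J, z, h): substitution t^{(k)}_a = z_{j^{(k)}_a} (t^{(N)}_a = z_a) *)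
definition Wval :: "nat list \<Rightarrow> nat set list \<Rightarrow> nat set list \<Rightarrow> complex \<Rightarrow> (nat \<Rightarrow> complex) \<Rightarrow> complex" where
  "Wval lam I J h z = (1 - h) ^ (\<Sum>k\<in>{1..<length lam}. lev lam k)
     * (\<Sum>\<sigma>\<in>symperms lam. Uval lam I h (\<lambda>k a. z (idx J k (\<sigma> k a))))"

definition generic :: "nat \<Rightarrow> (nat \<Rightarrow> complex) \<Rightarrow> bool" where
  "generic n z \<longleftrightarrow> (\<forall>a\<in>{1..n}. z a \<noteq> 0) \<and> (\<forall>a\<in>{1..n}. \<forall>b\<in>{1..n}. a \<noteq> b \<longrightarrow> z a \<noteq> z b)"

(* W_I(z_J, z, 0) as a Laurent polynomial in z_1..z_n: the Laurent polynomial
   agreeing with the rational expression wherever the latter is defined *)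
definition Wres :: "nat list \<Rightarrow> nat \<Rightarrow> nat set list \<Rightarrow> nat set list \<Rightarrow> lpoly" where
  "Wres lam n I J = (THE f. vars f \<subseteq> {Z a | a. a \<in> {1..n}}
      \<and> (\<forall>z. generic n z \<longrightarrow>
            evalp (\<lambda>v. case v of Z a \<Rightarrow> z a | G _ _ \<Rightarrow> 0) f = Wval lam I J 0 z))"

end

theory Submission
  imports Defs
begin

text \<open>
  Uniqueness: let \<open>d\<close> be the difference of two classes. If \<open>a < b\<close> and \<open>a\<close> lies in an earlier block of \<open>J\<close>
  than \<open>b\<close>, the restrictions of \<open>d\<close> to \<open>J\<close> and to the partition with \<open>a\<close> and \<open>b\<close> exchanged agree on
  \<open>z\<^sub>a = z\<^sub>b\<close>. Exchanging decreases \<open>\<Sum>\<^sub>c c \<cdot> block(c)\<close>, so by induction \<open>d\<close> at \<open>J\<close> is divisible by every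
  \<open>1 - z\<^sub>b/z\<^sub>a\<close>, hence by their product \<open>Pdiag J\<close>, whose \<open>phi J\<close>-width is \<open>mJ J\<close>. As the width of
  \<open>d\<close> at \<open>J\<close> is at most \<open>mJ J - 1\<close>, it vanishes.

  Existence: multiplying \<open>W\<^sub>I\<close> by the product of \<open>1 - t\<^sub>b/t\<^sub>a\<close> over all ordered pairs of each level gives a
  symmetric Laurent polynomial vanishing on every \<open>t\<^sub>a = t\<^sub>b\<close>. By symmetry it vanishes there to second
  order, so \<open>W\<^sub>I\<close> is a Laurent polynomial. In \<open>W\<^sub>I(z\<^sub>J, z, 0)\<close> a summand given by bijections
  \<open>p\<^sub>k : J\<^sub>1 \<union> \<dots> \<union> J\<^sub>k \<rightarrow> I\<^sub>1 \<union> \<dots> \<union> I\<^sub>k\<close> is nonzero only if \<open>p\<^sub>k\<^sub>+\<^sub>1 \<le> p\<^sub>k\<close> pointwise. Then the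
  \<open>phi J\<close>-degree of the numerator of level \<open>k\<close> is at most that of the denominator of level \<open>k + 1\<close>, strictly
  for the largest \<open>k\<close> with \<open>p\<^sub>k \<noteq> id\<close>, and the sum telescopes to at most \<open>mJ J - 1\<close>. For \<open>J = I\<close> only the
  identity contributes.
\<close>

section \<open>Laurent polynomials as functions on the torus\<close>

text \<open>The library derives that \<open>lpoly\<close> is an integral domain from a linear order on the variables.\<close>

instantiation var :: linorder
begin

fun less_eq_var :: "var \<Rightarrow> var \<Rightarrow> bool" where
  "less_eq_var (G k a) (G l b) \<longleftrightarrow> k < l \<or> k = l \<and> a \<le> b"
| "less_eq_var (G k a) (Z b) \<longleftrightarrow> True"
| "less_eq_var (Z a) (G l b) \<longleftrightarrow> False"
| "less_eq_var (Z a) (Z b) \<longleftrightarrow> a \<le> b"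

definition less_var :: "var \<Rightarrow> var \<Rightarrow> bool" where
  "less_var v w \<longleftrightarrow> v \<le> w \<and> \<not> w \<le> v"

instance
proof
  fix x y z :: var
  show "(x < y) = (x \<le> y \<and> \<not> y \<le> x)" by (fact less_var_def)
  show "x \<le> x" by (cases x) auto
  show "x \<le> y \<Longrightarrow> y \<le> z \<Longrightarrow> x \<le> z" by (cases x; cases y; cases z) auto
  show "x \<le> y \<Longrightarrow> y \<le> x \<Longrightarrow> x = y" by (cases x; cases y) auto
  show "x \<le> y \<or> y \<le> x" by (cases x; cases y) auto
qed

end

section \<open>Monomials as characters of the torus, and evaluation of Laurent polynomials\<close>

definition mon :: "(var \<Rightarrow> complex) \<Rightarrow> (var \<Rightarrow>\<^sub>0 int) \<Rightarrow> complex" where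
  "mon x e = (\<Prod>v\<in>Poly_Mapping.keys e. x v powi Poly_Mapping.lookup e v)"

text \<open>The points of the torus. Evaluation is guaranteed to be multiplicative only there,
  because \<open>0 powi k\<close> is \<open>0\<close> for negative \<open>k\<close> as well.\<close>

definition nonzero :: "(var \<Rightarrow> complex) \<Rightarrow> bool" where
  "nonzero x \<longleftrightarrow> (\<forall>v. x v \<noteq> 0)"

lemma mon_superset:
  assumes "finite A" "Poly_Mapping.keys e \<subseteq> A"
  shows "mon x e = (\<Prod>v\<in>A. x v powi Poly_Mapping.lookup e v)"
  unfolding mon_def by (rule prod.mono_neutral_left) (use assms in \<open>auto simp: in_keys_iff\<close>)

lemma mon_0 [simp]: "mon x 0 = 1"
  by (simp add: mon_def)

lemma mon_single [simp]: "mon x (Poly_Mapping.single v k) = x v powi k"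
  by (simp add: mon_def)

lemma mon_add: "nonzero x \<Longrightarrow> mon x (e + e') = mon x e * mon x e'"
  using keys_add[of e e']
  by (simp add: mon_superset[of "Poly_Mapping.keys e \<union> Poly_Mapping.keys e'"] lookup_add
      power_int_add nonzero_def prod.distrib)

lemma mon_sum: "nonzero x \<Longrightarrow> mon x (sum f A) = (\<Prod>i\<in>A. mon x (f i))"
  by (induction A rule: infinite_finite_induct) (auto simp: mon_add)

lemma mon_mult: "mon (\<lambda>v. x v * y v) e = mon x e * mon y e"
  by (simp add: mon_def power_int_mult_distrib prod.distrib)

lemma mon_const_1 [simp]: "mon (\<lambda>_. 1) e = 1"
  by (simp add: mon_def)

text \<open>The one-parameter subgroup of the coordinate \<open>v\<close> reads off the exponent of
  \<open>v\<close>. With \<open>c = 2\<close>, which is not a root of unity, distinct exponents give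
  distinct values (\<open>two_powi_eq_iff\<close>).\<close>

lemma mon_scale_var: "mon (\<lambda>w. if w = v then c else 1) e = c powi Poly_Mapping.lookup e v"
proof -
  have "mon (\<lambda>w. if w = v then c else 1) e
      = (\<Prod>w\<in>insert v (Poly_Mapping.keys e). (if w = v then c else 1) powi Poly_Mapping.lookup e w)"
    by (rule mon_superset) auto
  also have "\<dots> = (\<Prod>w\<in>insert v (Poly_Mapping.keys e). if w = v then c powi Poly_Mapping.lookup e v else 1)"
    by (rule prod.cong) auto
  also have "\<dots> = c powi Poly_Mapping.lookup e v"
    by simp
  finally show ?thesis .
qed

lemma mon_rename_exp:
  assumes "nonzero x"
  shows "mon x (rename_exp \<rho> e) = mon (\<lambda>v. x (\<rho> v)) e"
  unfolding rename_exp_def mon_sum[OF assms] mon_single by (simp add: mon_def)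

lemma two_powi_eq_iff: "(2::complex) powi a = 2 powi b \<longleftrightarrow> a = b"
proof
  assume "(2::complex) powi a = 2 powi b"
  then have "norm ((2::complex) powi a) = norm ((2::complex) powi b)" by simp
  then have *: "(2::real) powi a = 2 powi b" by (simp add: norm_power_int)
  show "a = b"
    using power_int_strict_increasing[of a b "2::real"] power_int_strict_increasing[of b a "2::real"] *
    by (cases a b rule: linorder_cases) auto
qed simp

lemma evalp_superset:
  assumes "finite A" "Poly_Mapping.keys f \<subseteq> A"
  shows "evalp x f = (\<Sum>e\<in>A. Poly_Mapping.lookup f e * mon x e)"
  unfolding evalp_def mon_def by (rule sum.mono_neutral_left) (use assms in \<open>auto simp: in_keys_iff\<close>)

lemma evalp_0 [simp]: "evalp x 0 = 0"
  by (simp add: evalp_def)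

lemma evalp_single [simp]: "evalp x (Poly_Mapping.single e c) = c * mon x e"
  by (simp add: evalp_def mon_def)

lemma evalp_1 [simp]: "evalp x 1 = 1"
  by (simp flip: single_one)

lemma evalp_add: "evalp x (f + g) = evalp x f + evalp x g"
  using keys_add[of f g]
  by (simp add: evalp_superset[of "Poly_Mapping.keys f \<union> Poly_Mapping.keys g"] lookup_add
      algebra_simps sum.distrib)

lemma evalp_uminus: "evalp x (- f) = - evalp x f"
  using evalp_add[of x f "- f"] by (simp add: eq_neg_iff_add_eq_0 add.commute)

lemma evalp_diff: "evalp x (f - g) = evalp x f - evalp x g"
  using evalp_add[of x f "- g"] by (simp add: evalp_uminus)

lemma evalp_sum: "evalp x (sum f A) = (\<Sum>i\<in>A. evalp x (f i))"
  by (induction A rule: infinite_finite_induct) (auto simp: evalp_add)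

lemma lpoly_expand:
  "f = (\<Sum>e\<in>Poly_Mapping.keys f. Poly_Mapping.single e (Poly_Mapping.lookup f e))"
proof (rule poly_mapping_eqI)
  fix k
  show "Poly_Mapping.lookup f k =
      Poly_Mapping.lookup (\<Sum>e\<in>Poly_Mapping.keys f. Poly_Mapping.single e (Poly_Mapping.lookup f e)) k"
    by (simp add: lookup_sum lookup_single when_def in_keys_iff)
qed

lemma evalp_mult:
  assumes "nonzero x"
  shows "evalp x (f * g) = evalp x f * evalp x g"
proof -
  have "f * g = (\<Sum>e\<in>Poly_Mapping.keys f. Poly_Mapping.single e (Poly_Mapping.lookup f e))
      * (\<Sum>e\<in>Poly_Mapping.keys g. Poly_Mapping.single e (Poly_Mapping.lookup g e))"
    using lpoly_expand[of f] lpoly_expand[of g] by simp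
  then have "evalp x (f * g) = (\<Sum>e\<in>Poly_Mapping.keys f. Poly_Mapping.lookup f e * mon x e)
      * (\<Sum>e\<in>Poly_Mapping.keys g. Poly_Mapping.lookup g e * mon x e)"
    by (simp add: sum_product evalp_sum mult_single mon_add[OF assms] mult_ac)
  then show ?thesis
    by (simp add: evalp_def mon_def)
qed

lemma evalp_prod: "nonzero x \<Longrightarrow> evalp x (prod f A) = (\<Prod>i\<in>A. evalp x (f i))"
  by (induction A rule: infinite_finite_induct) (auto simp: evalp_mult)

lemma evalp_power: "nonzero x \<Longrightarrow> evalp x (f ^ k) = evalp x f ^ k"
  by (induction k) (auto simp: evalp_mult)

lemma evalp_rename:
  "nonzero x \<Longrightarrow> evalp x (rename \<rho> f) = evalp (\<lambda>v. x (\<rho> v)) f"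
  by (simp add: rename_def evalp_sum mon_rename_exp) (simp add: evalp_def mon_def)

lemma evalp_cong:
  assumes "\<And>v. v \<in> vars f \<Longrightarrow> x v = y v"
  shows "evalp x f = evalp y f"
  unfolding evalp_def
  by (intro sum.cong refl arg_cong2[where f = "(*)"] prod.cong arg_cong2[where f = power_int])
    (use assms in \<open>auto simp: vars_def\<close>)

text \<open>Dedekind's independence of characters, for the characters \<open>mon \<cdot> e\<close> of the torus.\<close>

lemma mon_independent:
  assumes "finite A" "\<And>x. nonzero x \<Longrightarrow> (\<Sum>e\<in>A. c e * mon x e) = 0" "e \<in> A"
  shows "c e = 0"
  using assms
proof (induction A arbitrary: c e rule: finite_induct)
  case (insert e0 A)
  have c: "c e = 0" if e: "e \<in> A" for e
  proof -
    from e insert.hyps have "e \<noteq> e0" by auto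
    then obtain v where v: "Poly_Mapping.lookup e v \<noteq> Poly_Mapping.lookup e0 v"
      using poly_mapping_eqI[of e e0] by blast
    \<comment> \<open>Translating the relation by \<open>y\<close> and subtracting
      \<open>mon y e0\<close> times the original eliminates \<open>e0\<close>; \<open>y\<close> is
      chosen so that the characters \<open>e\<close> and \<open>e0\<close> differ at it.\<close>
    define y :: "var \<Rightarrow> complex" where "y = (\<lambda>w. if w = v then 2 else 1)"
    have y: "nonzero y" by (auto simp: y_def nonzero_def)
    have "(\<Sum>e\<in>A. (c e * (mon y e - mon y e0)) * mon x e) = 0" if x: "nonzero x" for x
    proof -
      have "nonzero (\<lambda>v. y v * x v)" using x y by (auto simp: nonzero_def)
      then have "(\<Sum>e\<in>insert e0 A. c e * mon (\<lambda>v. y v * x v) e)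
          - mon y e0 * (\<Sum>e\<in>insert e0 A. c e * mon x e) = 0"
        using insert.prems(1) x by simp
      then show ?thesis
        using insert.hyps
        by (simp add: mon_mult algebra_simps sum_subtractf sum_distrib_left)
    qed
    from insert.IH[OF this e] have "c e * (mon y e - mon y e0) = 0" .
    with v show ?thesis by (simp add: y_def mon_scale_var two_powi_eq_iff)
  qed
  moreover have "c e0 = 0"
    using insert.prems(1)[of "\<lambda>_. 1"] insert.hyps c by (simp add: nonzero_def)
  ultimately show ?case using insert.prems(2) by auto
qed simp

lemma lpoly_eq_0I:
  assumes "\<And>x. nonzero x \<Longrightarrow> evalp x f = 0"
  shows "f = 0"
proof (rule poly_mapping_eqI)
  fix e
  have "(\<Sum>e\<in>Poly_Mapping.keys f. Poly_Mapping.lookup f e * mon x e) = 0" if "nonzero x" for x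
    using assms[OF that] by (simp add: evalp_def mon_def)
  from mon_independent[OF finite_keys this, of e] show "Poly_Mapping.lookup f e = Poly_Mapping.lookup 0 e"
    by (cases "e \<in> Poly_Mapping.keys f") (auto simp: in_keys_iff)
qed

section \<open>Identities that hold off the diagonals\<close>

definition gen :: "var set \<Rightarrow> (var \<Rightarrow> complex) \<Rightarrow> bool" where
  "gen S x \<longleftrightarrow> nonzero x \<and> inj_on x S"

definition Xp :: "var \<Rightarrow> int \<Rightarrow> lpoly" where
  "Xp v k = Poly_Mapping.single (Poly_Mapping.single v k) 1"

text \<open>Up to a unit the equation of the diagonal \<open>u = v\<close>, normalized so that
  \<open>lin (Z a) (Z b)\<close> is the factor of \<open>Pdiag\<close> for the pair
  \<open>a\<close>, \<open>b\<close>.\<close>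

definition lin :: "var \<Rightarrow> var \<Rightarrow> lpoly" where
  "lin u v = 1 - Xp v 1 * Xp u (-1)"

lemma evalp_Xp [simp]: "evalp x (Xp v k) = x v powi k"
  by (simp add: Xp_def)

lemma evalp_lin: "nonzero x \<Longrightarrow> evalp x (lin u v) = 1 - x v / x u"
  by (simp add: lin_def evalp_diff evalp_mult power_int_minus divide_inverse)

lemma lin_nonzero: "u \<noteq> v \<Longrightarrow> lin u v \<noteq> 0"
proof
  assume "u \<noteq> v" "lin u v = 0"
  then have "evalp (\<lambda>w. if w = v then 2 else 1) (lin u v) = 0" by simp
  with \<open>u \<noteq> v\<close> show False by (subst (asm) evalp_lin) (auto simp: nonzero_def)
qed

lemma lin_self [simp]: "lin u u = 0"
  by (simp add: lin_def Xp_def mult_single flip: single_add)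

text \<open>Multiplying by the equations of all diagonals in \<open>S\<close> makes the identity
  hold on the entire torus, and these factors can be cancelled in an integral domain.\<close>

lemma lpoly_eqI:
  assumes "finite S" "\<And>x. gen S x \<Longrightarrow> evalp x f = evalp x g"
  shows "f = g"
proof -
  define P where "P = {(u, v). u \<in> S \<and> v \<in> S \<and> u \<noteq> v}"
  have fin: "finite P"
    by (rule finite_subset[of _ "S \<times> S"]) (use assms(1) in \<open>auto simp: P_def\<close>)
  define D where "D = (\<Prod>(u, v)\<in>P. lin u v)"
  have "D \<noteq> 0"
    using fin by (auto simp: D_def P_def lin_nonzero)
  have "(f - g) * D = 0"
  proof (rule lpoly_eq_0I)
    fix x assume x: "nonzero x"
    show "evalp x ((f - g) * D) = 0"
    proof (cases "gen S x")
      case True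
      then show ?thesis using assms(2) x by (simp add: evalp_mult evalp_diff)
    next
      case False
      then obtain u v where uv: "(u, v) \<in> P" "x u = x v"
        using x by (auto simp: gen_def inj_on_def P_def)
      have "evalp x (lin u v) = 0"
        using x uv by (simp add: evalp_lin) (simp add: nonzero_def)
      then have "evalp x D = 0"
        using uv fin x by (auto simp: D_def evalp_prod intro!: bexI[of _ "(u, v)"])
      then show ?thesis using x by (simp add: evalp_mult)
    qed
  qed
  with \<open>D \<noteq> 0\<close> show ?thesis by simp
qed

text \<open>Scaling a variable outside \<open>V\<close> by \<open>2\<close> leaves the values of
  \<open>f\<close> unchanged, so by independence of characters its exponent is \<open>0\<close>
  throughout. As \<open>S \<subseteq> V\<close>, the scaling does not leave the generic
  points.\<close>

lemma lpoly_vars_subsetI: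
  assumes "finite S" "S \<subseteq> V"
    and "\<And>x y. gen S x \<Longrightarrow> gen S y \<Longrightarrow> (\<And>v. v \<in> V \<Longrightarrow> x v = y v) \<Longrightarrow> evalp x f = evalp y f"
  shows "vars f \<subseteq> V"
proof
  fix v assume "v \<in> vars f"
  then obtain e where e: "e \<in> Poly_Mapping.keys f" "v \<in> Poly_Mapping.keys e" by (auto simp: vars_def)
  show "v \<in> V"
  proof (rule ccontr)
    assume v: "v \<notin> V"
    \<comment> \<open>The difference between \<open>f\<close> at the scaled point and
      \<open>f\<close>, as a Laurent polynomial.\<close>
    define g where "g = (\<Sum>e\<in>Poly_Mapping.keys f. Poly_Mapping.single e
        (Poly_Mapping.lookup f e * (2 powi Poly_Mapping.lookup e v - 1)))"
    have "g = 0"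
    proof (rule lpoly_eqI[OF assms(1)])
      fix x assume x: "gen S x"
      define y where "y = (\<lambda>w. (if w = v then 2 else 1) * x w)"
      have y: "gen S y"
        using x v assms(2) by (auto simp: gen_def nonzero_def y_def inj_on_def)
      have "evalp x g = evalp y f - evalp x f"
        by (simp add: g_def evalp_sum y_def evalp_def[of _ f] algebra_simps sum_subtractf
              mon_mult mon_scale_var flip: mon_def)
      also have "evalp y f = evalp x f"
        by (rule assms(3)) (use x y v in \<open>auto simp: y_def\<close>)
      finally show "evalp x g = evalp x 0" by simp
    qed
    moreover have "Poly_Mapping.lookup g e = Poly_Mapping.lookup f e * (2 powi Poly_Mapping.lookup e v - 1)"
      using e by (simp add: g_def lookup_sum lookup_single when_def)
    ultimately have "2 powi Poly_Mapping.lookup e v = (2::complex) powi 0"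
      using e by (auto simp: in_keys_iff)
    then show False
      unfolding two_powi_eq_iff using e by (auto simp: in_keys_iff)
  qed
qed

lemma vars_rename:
  "vars (rename \<rho> f) \<subseteq> \<rho> ` vars f"
proof -
  have sub: "Poly_Mapping.keys (sum g A) \<subseteq> (\<Union>i\<in>A. Poly_Mapping.keys (g i))"
    for g :: "'b \<Rightarrow> 'c \<Rightarrow>\<^sub>0 'd::comm_monoid_add" and A
  proof (induction A rule: infinite_finite_induct)
    case (insert i A)
    then show ?case using keys_add[of "g i" "sum g A"] by auto
  qed auto
  have "Poly_Mapping.keys (rename \<rho> f) \<subseteq> rename_exp \<rho> ` Poly_Mapping.keys f"
    unfolding rename_def
    by (rule order_trans[OF sub]) (auto split: if_splits)
  moreover have "Poly_Mapping.keys (rename_exp \<rho> e) \<subseteq> \<rho> ` Poly_Mapping.keys e" for e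
    unfolding rename_exp_def
    by (rule order_trans[OF sub]) (auto split: if_splits)
  ultimately show ?thesis unfolding vars_def by fastforce
qed

lemma rename_mult: "rename \<rho> (f * g) = rename \<rho> f * rename \<rho> g"
proof (rule lpoly_eqI[of "{}"])
  fix x assume "gen {} x"
  then have "nonzero x" "nonzero (\<lambda>v. x (\<rho> v))" by (auto simp: gen_def nonzero_def)
  then show "evalp x (rename \<rho> (f * g)) = evalp x (rename \<rho> f * rename \<rho> g)"
    by (simp add: evalp_rename evalp_mult)
qed simp

lemma rename_diff: "rename \<rho> (f - g) = rename \<rho> f - rename \<rho> g"
  by (rule lpoly_eqI[of "{}"]) (simp_all add: gen_def evalp_rename evalp_diff)

section \<open>Divisibility by the equations of diagonals\<close>

definition merge :: "var \<Rightarrow> var \<Rightarrow> var \<Rightarrow> var" where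
  "merge u v w = (if w = v then u else w)"

lemma Xp_mult: "Xp v j * Xp v k = Xp v (j + k)"
  by (simp add: Xp_def mult_single single_add)

lemma Xp_0 [simp]: "Xp v 0 = 1"
  by (simp add: Xp_def)

lemma Xp_power: "Xp v k ^ m = Xp v (int m * k)"
  by (induction m) (simp_all add: Xp_mult algebra_simps)

text \<open>For \<open>k \<ge> 0\<close> a difference of powers is divisible by the difference of
  the bases; negative \<open>k\<close> reduces to \<open>- k\<close> by multiplying with the
  monomial \<open>Xp v k * Xp u k\<close>.\<close>

lemma lin_dvd_Xp_diff: "lin u v dvd Xp v k - Xp u k"
proof -
  have *: "lin u v dvd Xp v (int m) - Xp u (int m)" for m
  proof -
    have "Xp u 1 * lin u v = Xp u 1 - Xp v 1 * (Xp u (-1) * Xp u 1)"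
      by (simp add: lin_def algebra_simps)
    then have "Xp u 1 * lin u v = Xp u 1 - Xp v 1"
      by (simp add: Xp_mult)
    then have "lin u v dvd Xp v 1 - Xp u 1"
      by (metis dvd_minus_iff dvd_triv_right minus_diff_eq)
    also have "\<dots> dvd Xp v 1 ^ m - Xp u 1 ^ m"
      by (simp add: power_diff_sumr2)
    finally show ?thesis by (simp add: Xp_power)
  qed
  show ?thesis
  proof (cases "k \<ge> 0")
    case True
    then show ?thesis using *[of "nat k"] by simp
  next
    case False
    then have "lin u v dvd Xp v (- k) - Xp u (- k)" using *[of "nat (- k)"] by simp
    then have "lin u v dvd (Xp v (- k) - Xp u (- k)) * (Xp v k * Xp u k)" by (rule dvd_mult2)
    also have "(Xp v (- k) - Xp u (- k)) * (Xp v k * Xp u k)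
        = (Xp v (- k) * Xp v k) * Xp u k - (Xp u (- k) * Xp u k) * Xp v k"
      by (simp add: algebra_simps)
    also have "\<dots> = - (Xp v k - Xp u k)" by (simp add: Xp_mult)
    finally show ?thesis by (simp only: dvd_minus_iff)
  qed
qed

lemma rename_exp_merge:
  "rename_exp (merge u v) e
    = e - Poly_Mapping.single v (Poly_Mapping.lookup e v) + Poly_Mapping.single u (Poly_Mapping.lookup e v)"
proof (cases "v \<in> Poly_Mapping.keys e")
  case True
  have "rename_exp (merge u v) e = Poly_Mapping.single u (Poly_Mapping.lookup e v)
      + (\<Sum>w\<in>Poly_Mapping.keys e - {v}. Poly_Mapping.single w (Poly_Mapping.lookup e w))"
    unfolding rename_exp_def
    by (subst sum.remove[OF _ True]) (auto simp: merge_def intro!: sum.cong)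
  moreover have "e = Poly_Mapping.single v (Poly_Mapping.lookup e v)
      + (\<Sum>w\<in>Poly_Mapping.keys e - {v}. Poly_Mapping.single w (Poly_Mapping.lookup e w))"
  proof (rule poly_mapping_eqI)
    fix k
    show "Poly_Mapping.lookup e k = Poly_Mapping.lookup (Poly_Mapping.single v (Poly_Mapping.lookup e v)
      + (\<Sum>w\<in>Poly_Mapping.keys e - {v}. Poly_Mapping.single w (Poly_Mapping.lookup e w))) k"
      by (auto simp add: lookup_add lookup_sum lookup_single when_def in_keys_iff)
  qed
  ultimately show ?thesis
    by (metis (no_types, lifting) add.commute add_diff_cancel_left')
next
  case False
  have "rename_exp (merge u v) e = (\<Sum>w\<in>Poly_Mapping.keys e. Poly_Mapping.single w (Poly_Mapping.lookup e w))"
    unfolding rename_exp_def using False by (auto simp: merge_def intro!: sum.cong)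
  also have "\<dots> = e"
    by (rule poly_mapping_eqI) (auto simp add: lookup_sum lookup_single when_def in_keys_iff)
  finally show ?thesis using False by (simp add: in_keys_iff)
qed

text \<open>Monomial by monomial: setting \<open>v\<close> equal to \<open>u\<close> changes a
  monomial by a multiple of \<open>Xp v k - Xp u k\<close>, where \<open>k\<close> is its exponent
  of \<open>v\<close>.\<close>

lemma lin_dvd_diff_rename_merge: "lin u v dvd f - rename (merge u v) f"
proof -
  have "f - rename (merge u v) f = (\<Sum>e\<in>Poly_Mapping.keys f.
      Poly_Mapping.single e (Poly_Mapping.lookup f e)
      - Poly_Mapping.single (rename_exp (merge u v) e) (Poly_Mapping.lookup f e))"
    unfolding sum_subtractf rename_def using lpoly_expand[of f] by simp
  also have "lin u v dvd \<dots>"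
  proof (rule dvd_sum)
    fix e
    let ?c = "Poly_Mapping.lookup f e" and ?k = "Poly_Mapping.lookup e v"
    have "Poly_Mapping.single e ?c - Poly_Mapping.single (rename_exp (merge u v) e) ?c
      = Poly_Mapping.single (e - Poly_Mapping.single v ?k) ?c * (Xp v ?k - Xp u ?k)"
      by (simp add: right_diff_distrib Xp_def mult_single rename_exp_merge)
    then show "lin u v dvd Poly_Mapping.single e ?c - Poly_Mapping.single (rename_exp (merge u v) e) ?c"
      using lin_dvd_Xp_diff by simp
  qed
  finally show ?thesis .
qed

lemma rename_lin: "rename \<rho> (lin u v) = lin (\<rho> u) (\<rho> v)"
proof (rule lpoly_eqI[of "{}"])
  fix x assume "gen {} x"
  then have "nonzero x" "nonzero (\<lambda>v. x (\<rho> v))" by (auto simp: gen_def nonzero_def)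
  then show "evalp x (rename \<rho> (lin u v)) = evalp x (lin (\<rho> u) (\<rho> v))"
    by (simp add: evalp_rename evalp_lin)
qed simp

text \<open>Factor theorem: the ideal of \<open>lin u v\<close> is the kernel of the substitution
  \<open>v := u\<close>. The target of this ring homomorphism is an integral domain, whence
  \<open>lin_dvd_multD\<close>.\<close>

lemma lin_dvd_iff: "lin u v dvd f \<longleftrightarrow> rename (merge u v) f = 0"
proof
  assume "lin u v dvd f"
  then show "rename (merge u v) f = 0"
    by (auto simp: rename_mult rename_lin merge_def)
next
  assume "rename (merge u v) f = 0"
  then show "lin u v dvd f" using lin_dvd_diff_rename_merge[of u v f] by simp
qed

lemma lin_dvd_multD: "lin u v dvd f * g \<Longrightarrow> lin u v dvd f \<or> lin u v dvd g"
  by (simp add: lin_dvd_iff rename_mult)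

lemma lin_dvd_lin:
  assumes "lin u v dvd lin u' v'" "u' \<noteq> v'"
  shows "{u', v'} = {u, v}"
proof -
  have "lin (merge u v u') (merge u v v') = 0"
    using assms(1) by (simp add: lin_dvd_iff rename_lin)
  then have "merge u v u' = merge u v v'" using lin_nonzero by blast
  with assms(2) show ?thesis by (auto simp: merge_def split: if_splits)
qed

lemma lin_power_dvd_multD:
  assumes "u \<noteq> v" "lin u v ^ m dvd f * g" "\<not> lin u v dvd g"
  shows "lin u v ^ m dvd f"
  using assms(2)
proof (induction m arbitrary: f)
  case (Suc m)
  from Suc.prems have "lin u v dvd f * g"
    by (metis dvd_trans dvd_triv_left power_Suc)
  then have "lin u v dvd f" using assms(3) lin_dvd_multD by blast
  then obtain f' where f': "f = lin u v * f'" ..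
  with Suc.prems have "lin u v * lin u v ^ m dvd lin u v * (f' * g)" by (simp add: mult.assoc)
  then have "lin u v ^ m dvd f' * g" using lin_nonzero[OF assms(1)] by simp
  from Suc.IH[OF this] show ?case by (simp add: f')
qed simp

text \<open>The factors are pairwise non-associated primes, so divisibility by each power gives
  divisibility by the product. Since \<open>lin u v\<close> and \<open>lin v u\<close> are
  associated, \<open>E\<close> may contain a pair in one orientation only. Uniqueness uses
  \<open>m = 1\<close>, the weight function \<open>m = 2\<close>.\<close>

lemma prod_lin_power_dvd:
  assumes "finite E" "\<And>u v. (u, v) \<in> E \<Longrightarrow> u \<noteq> v"
    and "\<And>u v u' v'. (u, v) \<in> E \<Longrightarrow> (u', v') \<in> E \<Longrightarrow> {u, v} = {u', v'} \<Longrightarrow> (u, v) = (u', v')"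
    and "\<And>u v. (u, v) \<in> E \<Longrightarrow> lin u v ^ m dvd f"
  shows "(\<Prod>(u, v)\<in>E. lin u v ^ m) dvd f"
  using assms
proof (induction E rule: finite_induct)
  case (insert p E)
  obtain u v where p: "p = (u, v)" by (cases p)
  have uv: "u \<noteq> v" using insert.prems(1) p by auto
  have "(\<Prod>(u, v)\<in>E. lin u v ^ m) dvd f"
    by (rule insert.IH) (use insert.prems in \<open>blast+\<close>)
  then obtain g where g: "f = g * (\<Prod>(u, v)\<in>E. lin u v ^ m)" by (metis dvdE mult.commute)
  \<comment> \<open>By primality it is enough that \<open>lin u v\<close> divides no single factor.
    The claim for all subsets \<open>E'\<close> makes the inner induction independent of the
    hypotheses on \<open>E\<close>.\<close>
  have "\<not> lin u v dvd (\<Prod>(u, v)\<in>E'. lin u v ^ m)" if "E' \<subseteq> E" for E'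
    using finite_subset[OF that insert.hyps(1)] that
  proof (induction E' rule: finite_induct)
    case empty
    have "rename (merge u v) 1 = 1"
      by (rule lpoly_eqI[of "{}"]) (simp_all add: gen_def evalp_rename)
    then show ?case by (simp add: lin_dvd_iff)
  next
    case (insert q E')
    obtain u' v' where q: "q = (u', v')" by (cases q)
    have "\<not> lin u v dvd lin u' v'"
    proof
      assume "lin u v dvd lin u' v'"
      moreover have "u' \<noteq> v'" using insert.prems q \<open>\<And>u' v'. (u', v') \<in> insert p E \<Longrightarrow> u' \<noteq> v'\<close> by blast
      ultimately have "{u', v'} = {u, v}" by (rule lin_dvd_lin)
      then have "q = p"
        using \<open>\<And>u v u' v'. (u, v) \<in> insert p E \<Longrightarrow> (u', v') \<in> insert p E \<Longrightarrow> {u, v} = {u', v'} \<Longrightarrow> (u, v) = (u', v')\<close>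
          insert.prems p q by blast
      with insert.prems \<open>p \<notin> E\<close> show False by auto
    qed
    then have "\<not> lin u v dvd lin u' v' ^ m"
    proof (induction m)
      case 0
      have "rename (merge u v) 1 = 1"
        by (rule lpoly_eqI[of "{}"]) (simp_all add: gen_def evalp_rename)
      then show ?case by (simp add: lin_dvd_iff)
    next
      case (Suc m)
      then show ?case using lin_dvd_multD[of u v "lin u' v'" "lin u' v' ^ m"] by auto
    qed
    moreover have "\<not> lin u v dvd (\<Prod>(u, v)\<in>E'. lin u v ^ m)" using insert by auto
    ultimately have "\<not> lin u v dvd lin u' v' ^ m * (\<Prod>(u, v)\<in>E'. lin u v ^ m)"
      using lin_dvd_multD by blast
    then show ?case using insert.hyps by (simp add: q)
  qed
  from this[of E] have "\<not> lin u v dvd (\<Prod>(u, v)\<in>E. lin u v ^ m)" by simp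
  moreover have "lin u v ^ m dvd f" using insert.prems(3) p by auto
  ultimately have "lin u v ^ m dvd g"
    unfolding g using lin_power_dvd_multD[OF uv] by blast
  then show ?case using insert.hyps by (simp add: p g mult_dvd_mono)
qed simp

section \<open>Degrees, Newton polytopes and uniqueness\<close>

definition wt :: "(var \<Rightarrow> int) \<Rightarrow> (var \<Rightarrow>\<^sub>0 int) \<Rightarrow> int" where
  "wt w e = (\<Sum>v\<in>Poly_Mapping.keys e. w v * Poly_Mapping.lookup e v)"

lemma wt_superset:
  assumes "finite A" "Poly_Mapping.keys e \<subseteq> A"
  shows "wt w e = (\<Sum>v\<in>A. w v * Poly_Mapping.lookup e v)"
  unfolding wt_def by (rule sum.mono_neutral_left) (use assms in \<open>auto simp: in_keys_iff\<close>)

lemma wt_0 [simp]: "wt w 0 = 0"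
  by (simp add: wt_def)

lemma wt_single [simp]: "wt w (Poly_Mapping.single v k) = w v * k"
  by (simp add: wt_def)

lemma wt_add: "wt w (e + e') = wt w e + wt w e'"
  using keys_add[of e e']
  by (simp add: wt_superset[of "Poly_Mapping.keys e \<union> Poly_Mapping.keys e'"] lookup_add
      algebra_simps sum.distrib)

lemma wt_uminus: "wt (\<lambda>v. - w v) e = - wt w e"
  by (simp add: wt_def sum_negf)

text \<open>A bound instead of a degree function, so that \<open>0\<close> satisfies every bound.
  Lower bounds on the weights are expressed as \<open>degle\<close> for the negated weight
  (\<open>wt_uminus\<close>).\<close>

definition degle :: "(var \<Rightarrow> int) \<Rightarrow> int \<Rightarrow> lpoly \<Rightarrow> bool" where
  "degle w d f \<longleftrightarrow> (\<forall>e\<in>Poly_Mapping.keys f. wt w e \<le> d)"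

definition topdeg :: "(var \<Rightarrow> int) \<Rightarrow> int \<Rightarrow> lpoly \<Rightarrow> bool" where
  "topdeg w d f \<longleftrightarrow> degle w d f \<and> (\<exists>e\<in>Poly_Mapping.keys f. wt w e = d)"

lemma degle_0 [simp]: "degle w d 0"
  by (simp add: degle_def)

lemma degle_mono: "degle w d f \<Longrightarrow> d \<le> d' \<Longrightarrow> degle w d' f"
  by (auto simp: degle_def)

lemma degle_add: "degle w d f \<Longrightarrow> degle w d g \<Longrightarrow> degle w d (f + g)"
  using keys_add[of f g] by (auto simp: degle_def)

lemma degle_uminus: "degle w d f \<Longrightarrow> degle w d (- f)"
  by (auto simp: degle_def in_keys_iff)

lemma degle_diff: "degle w d f \<Longrightarrow> degle w d g \<Longrightarrow> degle w d (f - g)"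
  using degle_add[of w d f "- g"] degle_uminus[of w d g] by simp

lemma degle_mult: "degle w d f \<Longrightarrow> degle w d' g \<Longrightarrow> degle w (d + d') (f * g)"
  using keys_mult[of f g] by (fastforce simp: degle_def wt_add intro: add_mono)

lemma degle_sum: "(\<And>i. i \<in> A \<Longrightarrow> degle w d (f i)) \<Longrightarrow> degle w d (sum f A)"
  by (induction A rule: infinite_finite_induct) (auto intro: degle_add)

lemma topdeg_1: "topdeg w 0 1"
  by (simp add: topdeg_def degle_def)

lemma topdeg_degle: "topdeg w d f \<Longrightarrow> degle w d' f \<Longrightarrow> d \<le> d'"
  by (auto simp: topdeg_def degle_def)

text \<open>The components of top weight of \<open>f\<close> and \<open>g\<close> have a nonzero
  product in an integral domain, and everything else in \<open>f * g\<close> has smaller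
  weight.\<close>

lemma topdeg_mult:
  assumes f: "topdeg w d f" and g: "topdeg w d' g"
  shows "topdeg w (d + d') (f * g)"
proof -
  define part where "part = (\<lambda>d f. \<Sum>e\<in>{e\<in>Poly_Mapping.keys f. wt w e = d}.
      Poly_Mapping.single e (Poly_Mapping.lookup f e :: complex))"
  have lookup_part: "Poly_Mapping.lookup (part d f) e = (if wt w e = d then Poly_Mapping.lookup f e else 0)"
    for d f e
    by (auto simp: part_def lookup_sum lookup_single when_def in_keys_iff)
  have part_nz: "part d f \<noteq> 0" if "topdeg w d f" for d f
  proof
    assume *: "part d f = 0"
    from that obtain e where "e \<in> Poly_Mapping.keys f" "wt w e = d" by (auto simp: topdeg_def)
    then show False using lookup_part[of d f e] * by (auto simp: in_keys_iff)
  qed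
  have rest: "degle w (d - 1) (f - part d f)" if "topdeg w d f" for d f
  proof -
    have "wt w e \<le> d - 1" if e: "e \<in> Poly_Mapping.keys (f - part d f)" for e
    proof -
      from e have "Poly_Mapping.lookup f e \<noteq> 0" "wt w e \<noteq> d"
        by (auto simp: in_keys_iff lookup_minus lookup_part split: if_splits)
      with \<open>topdeg w d f\<close> have "wt w e \<le> d" "wt w e \<noteq> d" by (auto simp: topdeg_def degle_def in_keys_iff)
      then show ?thesis by simp
    qed
    then show ?thesis by (simp add: degle_def)
  qed
  have part: "degle w d (part d f)" for d f
    by (auto simp: degle_def in_keys_iff lookup_part split: if_splits)
  have wt_part: "wt w e = d + d'" if e: "e \<in> Poly_Mapping.keys (part d f * part d' g)" for e
    using keys_mult[of "part d f" "part d' g"] e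
    by (auto simp: wt_add in_keys_iff lookup_part split: if_splits)
  \<comment> \<open>All products that involve a lower component of \<open>f\<close> or of
    \<open>g\<close>; their weights are too small to cancel the product of the top
    components.\<close>
  define r where "r = part d f * (g - part d' g) + (f - part d f) * g"
  have "degle w (d + d' - 1) r"
    unfolding r_def
  proof (rule degle_add)
    show "degle w (d + d' - 1) (part d f * (g - part d' g))"
      using degle_mult[OF part rest[OF g], of d f] by (simp add: add_diff_eq)
    show "degle w (d + d' - 1) ((f - part d f) * g)"
      using degle_mult[OF rest[OF f], of d' g] g by (simp add: topdeg_def diff_add_eq)
  qed
  then have r: "Poly_Mapping.lookup r e = 0" if "wt w e = d + d'" for e
    using that by (force simp: degle_def in_keys_iff)
  have fg: "f * g = part d f * part d' g + r"
    by (simp add: r_def algebra_simps)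
  have "part d f * part d' g \<noteq> 0" using part_nz[OF f] part_nz[OF g] by simp
  then obtain e where e: "Poly_Mapping.lookup (part d f * part d' g) e \<noteq> 0"
    using poly_mapping_eqI[of "part d f * part d' g" 0] by auto
  then have "wt w e = d + d'" using wt_part by (simp add: in_keys_iff)
  moreover have "e \<in> Poly_Mapping.keys (f * g)"
    using e r calculation by (simp add: fg in_keys_iff lookup_add)
  ultimately show ?thesis
    using degle_mult[of w d f d' g] f g by (auto simp: topdeg_def)
qed

lemma topdeg_prod:
  "(\<And>i. i \<in> A \<Longrightarrow> topdeg w (d i) (f i)) \<Longrightarrow> topdeg w (sum d A) (prod f A)"
  by (induction A rule: infinite_finite_induct) (auto intro: topdeg_mult topdeg_1)

lemma degle_prod:
  "(\<And>i. i \<in> A \<Longrightarrow> degle w (d i) (f i)) \<Longrightarrow> degle w (sum d A) (prod f A)"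
  by (induction A rule: infinite_finite_induct)
    (auto intro: degle_mult topdeg_1[unfolded topdeg_def, THEN conjunct1])

lemma topdeg_exists:
  assumes "f \<noteq> 0"
  obtains d where "topdeg w d f"
proof -
  from assms have ne: "Poly_Mapping.keys f \<noteq> {}"
    using poly_mapping_eqI[of f 0] by (auto simp: in_keys_iff)
  have "topdeg w (Max (wt w ` Poly_Mapping.keys f)) f"
    using Max_in[of "wt w ` Poly_Mapping.keys f"] ne
    unfolding topdeg_def degle_def by (metis (no_types, lifting) Max_ge finite_imageI finite_keys image_iff image_is_empty)
  then show ?thesis by (rule that)
qed

lemma topdeg_lin:
  assumes "u \<noteq> v"
  shows "topdeg w (max 0 (w v - w u)) (lin u v)"
proof -
  define e :: "var \<Rightarrow>\<^sub>0 int" where "e = Poly_Mapping.single v 1 + Poly_Mapping.single u (-1)"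
  have "Poly_Mapping.lookup e v = 1" using assms by (simp add: e_def lookup_add lookup_single)
  then have "e \<noteq> 0" by auto
  have "lin u v = 1 - Poly_Mapping.single e 1"
    by (simp add: lin_def Xp_def mult_single e_def)
  then have "Poly_Mapping.keys (lin u v) = {0, e}"
    using \<open>e \<noteq> 0\<close>
    by (auto simp: in_keys_iff lookup_minus lookup_one lookup_single when_def split: if_splits)
  then show ?thesis by (auto simp: topdeg_def degle_def e_def wt_add)
qed

text \<open>Includes \<open>u = v\<close>, where the factor is \<open>0\<close>: such factors do
  occur in \<open>Tpol\<close>.\<close>

lemma degle_lin: "degle w (max 0 (w v - w u)) (lin u v)"
  using topdeg_lin[of u v w] by (cases "u = v") (auto simp: topdeg_def)

definition phiw :: "nat set list \<Rightarrow> var \<Rightarrow> int" where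
  "phiw J v = (\<Sum>k<length J. if v \<in> Z ` (J ! k) then int (Suc k) else 0)"

text \<open>\<open>phiw J\<close> is \<open>phi J\<close> as an integer weight on the variables:
  \<open>Z a\<close> gets the number of its block counted from 1 (\<open>phiw_Z\<close>), the
  variables \<open>G\<close> get \<open>0\<close>.\<close>

lemma phi_exponent:
  assumes "\<forall>k<length J. finite (J ! k)"
  shows "phi J (\<lambda>a. real_of_int (Poly_Mapping.lookup e (Z a))) = real_of_int (wt (phiw J) e)"
proof -
  define A where "A = Poly_Mapping.keys e \<union> (\<Union>k<length J. Z ` (J ! k))"
  have fin: "finite A" using assms by (auto simp: A_def)
  have "wt (phiw J) e = (\<Sum>v\<in>A. phiw J v * Poly_Mapping.lookup e v)"
    by (rule wt_superset[OF fin]) (auto simp: A_def)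
  also have "\<dots> = (\<Sum>k<length J. \<Sum>v\<in>A. (if v \<in> Z ` (J ! k) then int (Suc k) * Poly_Mapping.lookup e v else 0))"
    unfolding phiw_def sum_distrib_right
    by (subst sum.swap) (auto intro!: sum.cong)
  also have "\<dots> = (\<Sum>k<length J. int (Suc k) * (\<Sum>a\<in>J ! k. Poly_Mapping.lookup e (Z a)))"
  proof (rule sum.cong[OF refl])
    fix k assume k: "k \<in> {..<length J}"
    have "(\<Sum>v\<in>A. (if v \<in> Z ` (J ! k) then int (Suc k) * Poly_Mapping.lookup e v else 0))
        = (\<Sum>v\<in>A \<inter> Z ` (J ! k). int (Suc k) * Poly_Mapping.lookup e v)"
      using sum.inter_restrict[OF fin, of "\<lambda>v. int (Suc k) * Poly_Mapping.lookup e v" "Z ` (J ! k)"] by simp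
    also have "A \<inter> Z ` (J ! k) = Z ` (J ! k)"
      using k by (auto simp: A_def)
    also have "(\<Sum>v\<in>Z ` (J ! k). int (Suc k) * Poly_Mapping.lookup e v)
        = (\<Sum>a\<in>J ! k. int (Suc k) * Poly_Mapping.lookup e (Z a))"
      by (subst sum.reindex) (auto simp: inj_on_def)
    finally show "(\<Sum>v\<in>A. (if v \<in> Z ` (J ! k) then int (Suc k) * Poly_Mapping.lookup e v else 0))
        = int (Suc k) * (\<Sum>a\<in>J ! k. Poly_Mapping.lookup e (Z a))"
      by (simp add: sum_distrib_left)
  qed
  finally show ?thesis by (simp add: phi_def)
qed

lemma phi_linear:
  "phi J (\<lambda>a. \<Sum>e\<in>A. u e * x e a) = (\<Sum>e\<in>A. u e * phi J (x e))"
proof -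
  have "(\<Sum>a\<in>B. \<Sum>e\<in>A. u e * x e a) = (\<Sum>e\<in>A. u e * (\<Sum>a\<in>B. x e a))" for B
    by (subst sum.swap) (simp add: sum_distrib_left)
  then show ?thesis
    by (simp add: phi_def sum_distrib_left mult_ac) (subst sum.swap, simp)
qed

lemma phi_newton:
  assumes "\<forall>k<length J. finite (J ! k)"
  shows "phi J ` newton f = {\<Sum>e\<in>Poly_Mapping.keys f. u e * real_of_int (wt (phiw J) e) | u.
      (\<forall>e\<in>Poly_Mapping.keys f. u e \<ge> 0) \<and> (\<Sum>e\<in>Poly_Mapping.keys f. u e) = 1}"
    (is "_ = ?R")
proof -
  have eq: "phi J (\<lambda>a. \<Sum>e\<in>Poly_Mapping.keys f. u e * real_of_int (Poly_Mapping.lookup e (Z a)))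
    = (\<Sum>e\<in>Poly_Mapping.keys f. u e * real_of_int (wt (phiw J) e))" for u
    by (simp add: phi_linear phi_exponent[OF assms])
  show ?thesis
    unfolding newton_def image_Collect by (force simp: eq)
qed

lemma wt_in_phi_newton:
  assumes "\<forall>k<length J. finite (J ! k)" "e \<in> Poly_Mapping.keys f"
  shows "real_of_int (wt (phiw J) e) \<in> phi J ` newton f"
  unfolding phi_newton[OF assms(1)] mem_Collect_eq
proof (intro exI[of _ "\<lambda>e'. if e' = e then 1 else 0"] conjI)
  have "(\<Sum>e'\<in>Poly_Mapping.keys f. (if e' = e then 1 else 0) * real_of_int (wt (phiw J) e'))
     = (\<Sum>e'\<in>Poly_Mapping.keys f. if e' = e then real_of_int (wt (phiw J) e) else 0)"
    by (rule sum.cong) auto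
  then show "real_of_int (wt (phiw J) e)
    = (\<Sum>e'\<in>Poly_Mapping.keys f. (if e' = e then 1 else 0) * real_of_int (wt (phiw J) e'))"
    using assms(2) by simp
qed (use assms(2) in auto)

text \<open>The image of the Newton polytope consists of the convex combinations of the weights of
  the exponents, and an interval is convex. For \<open>f = 0\<close> both sides hold
  vacuously.\<close>

lemma phi_newton_subset_iff:
  assumes "\<forall>k<length J. finite (J ! k)"
  shows "phi J ` newton f \<subseteq> {l..h} \<longleftrightarrow>
    (\<forall>e\<in>Poly_Mapping.keys f. l \<le> real_of_int (wt (phiw J) e) \<and> real_of_int (wt (phiw J) e) \<le> h)"
proof
  assume "phi J ` newton f \<subseteq> {l..h}"
  then show "\<forall>e\<in>Poly_Mapping.keys f. l \<le> real_of_int (wt (phiw J) e) \<and> real_of_int (wt (phiw J) e) \<le> h"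
    using wt_in_phi_newton[OF assms] by fastforce
next
  assume *: "\<forall>e\<in>Poly_Mapping.keys f. l \<le> real_of_int (wt (phiw J) e) \<and> real_of_int (wt (phiw J) e) \<le> h"
  show "phi J ` newton f \<subseteq> {l..h}"
  proof (subst phi_newton[OF assms]; safe)
    fix u :: "(var \<Rightarrow>\<^sub>0 int) \<Rightarrow> real"
    assume u: "\<forall>e\<in>Poly_Mapping.keys f. 0 \<le> u e" "(\<Sum>e\<in>Poly_Mapping.keys f. u e) = 1"
    have "(\<Sum>e\<in>Poly_Mapping.keys f. u e * l) \<le> (\<Sum>e\<in>Poly_Mapping.keys f. u e * real_of_int (wt (phiw J) e))"
      "(\<Sum>e\<in>Poly_Mapping.keys f. u e * real_of_int (wt (phiw J) e)) \<le> (\<Sum>e\<in>Poly_Mapping.keys f. u e * h)"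
      using * u by (auto intro!: sum_mono mult_left_mono)
    then show "(\<Sum>e\<in>Poly_Mapping.keys f. u e * real_of_int (wt (phiw J) e)) \<in> {l..h}"
      using u(2) by (simp flip: sum_distrib_right)
  qed
qed

lemma mJ_eq:
  assumes "\<forall>k<length J. finite (J ! k)" "topdeg (phiw J) d (Pdiag J)"
  shows "mJ J = real_of_int d"
  unfolding mJ_def
proof (rule cSup_eq_maximum)
  from assms(2) obtain e where "e \<in> Poly_Mapping.keys (Pdiag J)" "wt (phiw J) e = d"
    by (auto simp: topdeg_def)
  then show "real_of_int d \<in> phi J ` newton (Pdiag J)"
    using wt_in_phi_newton[OF assms(1)] by blast
next
  fix x assume x: "x \<in> phi J ` newton (Pdiag J)"
  \<comment> \<open>The interval criterion asks for a finite lower end; the smallest weight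
    serves.\<close>
  define l where "l = Min ((\<lambda>e. real_of_int (wt (phiw J) e)) ` Poly_Mapping.keys (Pdiag J))"
  have "phi J ` newton (Pdiag J) \<subseteq> {l..real_of_int d}"
    unfolding phi_newton_subset_iff[OF assms(1)]
    using assms(2) by (auto simp: topdeg_def degle_def l_def)
  with x show "x \<le> real_of_int d" by auto
qed

lemma Jsmall_iff:
  assumes "\<forall>k<length J. finite (J ! k)" "topdeg (phiw J) d (Pdiag J)"
  shows "Jsmall J f \<longleftrightarrow> degle (phiw J) (d - 1) f \<and> degle (\<lambda>v. - phiw J v) 0 f"
  unfolding Jsmall_def phi_newton_subset_iff[OF assms(1)] mJ_eq[OF assms]
  by (auto simp: degle_def wt_uminus)

section \<open>Ordered partitions, block functions and the product \<open>Pdiag\<close>\<close>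

context
  fixes lam n J
  assumes J: "J \<in> Ilam lam n"
begin

lemma Ilam_length: "length J = length lam"
  using J by (simp add: Ilam_def)

lemma Ilam_subset: "k < length lam \<Longrightarrow> J ! k \<subseteq> {1..n}"
  using J by (simp add: Ilam_def)

lemma Ilam_finite: "k < length lam \<Longrightarrow> finite (J ! k)"
  using Ilam_subset finite_subset by blast

lemma Ilam_card: "k < length lam \<Longrightarrow> card (J ! k) = lam ! k"
  using J by (simp add: Ilam_def)

lemma Ilam_disjoint:
  assumes "k < length lam" "l < length lam" "a \<in> J ! k" "a \<in> J ! l"
  shows "k = l"
proof (rule ccontr)
  have "\<forall>k l. k < l \<and> l < length lam \<longrightarrow> J ! k \<inter> J ! l = {}" using J by (simp add: Ilam_def)
  moreover assume "k \<noteq> l"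
  ultimately show False using assms by (metis disjoint_iff linorder_neqE_nat)
qed

lemma Ilam_cover:
  assumes "a \<in> {1..n}"
  obtains k where "k < length lam" "a \<in> J ! k"
proof -
  have "a \<in> \<Union> (set J)" using J assms by (simp add: Ilam_def)
  then show ?thesis using that Ilam_length by (auto simp: in_set_conv_nth)
qed

end

text \<open>The number of the block of \<open>a\<close> counted from 0, hence one less than in
  \<open>phi\<close>. A partition is determined by this function on \<open>{1..n}\<close>
  (\<open>Ilam_eqI\<close>).\<close>

definition blk :: "nat set list \<Rightarrow> nat \<Rightarrow> nat" where
  "blk J a = (THE k. k < length J \<and> a \<in> J ! k)"

lemma blk_eqI:
  assumes "J \<in> Ilam lam n" "k < length lam" "a \<in> J ! k"
  shows "blk J a = k"
  unfolding blk_def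
  by (rule the_equality) (use assms Ilam_disjoint[OF assms(1)] Ilam_length[OF assms(1)] in auto)

lemma blk_props:
  assumes "J \<in> Ilam lam n" "a \<in> {1..n}"
  shows "blk J a < length lam" "a \<in> J ! blk J a"
proof -
  obtain k where "k < length lam" "a \<in> J ! k" using Ilam_cover[OF assms] .
  with blk_eqI[OF assms(1)] show "blk J a < length lam" "a \<in> J ! blk J a" by auto
qed

lemma mem_block_iff:
  assumes "J \<in> Ilam lam n" "k < length lam"
  shows "a \<in> J ! k \<longleftrightarrow> a \<in> {1..n} \<and> blk J a = k"
  using blk_props[OF assms(1)] blk_eqI[OF assms] Ilam_subset[OF assms] by auto

lemma Ilam_eqI:
  assumes "I \<in> Ilam lam n" "J \<in> Ilam lam n" "\<And>a. a \<in> {1..n} \<Longrightarrow> blk I a = blk J a"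
  shows "I = J"
proof (rule nth_equalityI)
  show "length I = length J" using Ilam_length assms(1,2) by metis
  fix k assume "k < length I"
  then have k: "k < length lam" by (simp add: Ilam_length[OF assms(1)])
  show "I ! k = J ! k"
    by (rule set_eqI) (use mem_block_iff[OF assms(1) k] mem_block_iff[OF assms(2) k] assms(3) in auto)
qed

lemma phiw_Z:
  assumes "J \<in> Ilam lam n" "a \<in> {1..n}"
  shows "phiw J (Z a) = int (Suc (blk J a))"
proof -
  have "phiw J (Z a) = (\<Sum>k<length J. if k = blk J a then int (Suc (blk J a)) else 0)"
    unfolding phiw_def
    by (rule sum.cong) (use mem_block_iff[OF assms(1)] assms(2) Ilam_length[OF assms(1)] in auto)
  then show ?thesis using blk_props[OF assms] Ilam_length[OF assms(1)] by simp
qed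

text \<open>The index set of the factors of \<open>Pdiag J\<close>
  (\<open>Pdiag_eq\<close>).\<close>

definition noninv :: "nat \<Rightarrow> nat set list \<Rightarrow> (nat \<times> nat) set" where
  "noninv n J = {(a, b). a \<in> {1..n} \<and> b \<in> {1..n} \<and> a < b \<and> blk J a < blk J b}"

lemma finite_noninv [simp]: "finite (noninv n J)"
  by (rule finite_subset[of _ "{1..n} \<times> {1..n}"]) (auto simp: noninv_def)

lemma Pdiag_eq:
  assumes J: "J \<in> Ilam lam n"
  shows "Pdiag J = (\<Prod>(a, b)\<in>noninv n J. lin (Z a) (Z b))"
proof -
  let ?N = "length lam"
  let ?S = "SIGMA k:{..<?N}. SIGMA l:{k<..<?N}. SIGMA a:J!k. {b\<in>J!l. a < b}"
  have "Pdiag J = (\<Prod>k<?N. \<Prod>l\<in>{k<..<?N}. \<Prod>a\<in>J!k. \<Prod>b\<in>{b\<in>J!l. a < b}. lin (Z a) (Z b))"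
    unfolding Pdiag_def Ilam_length[OF J] by (simp add: lin_def Xp_def zv_def zinv_def)
  also have "\<dots> = (\<Prod>k<?N. \<Prod>l\<in>{k<..<?N}. \<Prod>(a, b)\<in>(SIGMA a:J!k. {b\<in>J!l. a < b}). lin (Z a) (Z b))"
    using Ilam_finite[OF J] by (intro prod.cong prod.Sigma refl) auto
  also have "\<dots> = (\<Prod>k<?N. \<Prod>(l, a, b)\<in>(SIGMA l:{k<..<?N}. SIGMA a:J!k. {b\<in>J!l. a < b}). lin (Z a) (Z b))"
    using Ilam_finite[OF J] by (intro prod.cong prod.Sigma refl) auto
  also have "\<dots> = (\<Prod>(k, l, a, b)\<in>?S. lin (Z a) (Z b))"
    using Ilam_finite[OF J] by (intro prod.Sigma) auto
  also have "\<dots> = (\<Prod>(a, b)\<in>noninv n J. lin (Z a) (Z b))"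
  proof (rule prod.reindex_bij_witness[of _ "\<lambda>(a, b). (blk J a, blk J b, a, b)" "\<lambda>(k, l, a, b). (a, b)"])
    fix q assume "q \<in> ?S"
    then show "(case case q of (k, l, a, b) \<Rightarrow> (a, b) of (a, b) \<Rightarrow> (blk J a, blk J b, a, b)) = q"
      "(case q of (k, l, a, b) \<Rightarrow> (a, b)) \<in> noninv n J"
      "(case case q of (k, l, a, b) \<Rightarrow> (a, b) of (a, b) \<Rightarrow> lin (Z a) (Z b)) = (case q of (k, l, a, b) \<Rightarrow> lin (Z a) (Z b))"
      by (auto simp: noninv_def mem_block_iff[OF J])
  next
    fix p assume "p \<in> noninv n J"
    then show "(case case p of (a, b) \<Rightarrow> (blk J a, blk J b, a, b) of (k, l, a, b) \<Rightarrow> (a, b)) = p"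
      "(case p of (a, b) \<Rightarrow> (blk J a, blk J b, a, b)) \<in> ?S"
      using blk_props[OF J] by (auto simp: noninv_def)
  qed
  finally show ?thesis .
qed

text \<open>The integer form of \<open>mJ J\<close>, by \<open>topdeg_Pdiag\<close> and
  \<open>mJ_eq\<close>: the factor of a pair contributes the difference of the two block
  numbers.\<close>

definition mdeg :: "nat \<Rightarrow> nat set list \<Rightarrow> int" where
  "mdeg n J = (\<Sum>(a, b)\<in>noninv n J. int (blk J b) - int (blk J a))"

lemma topdeg_Pdiag:
  assumes J: "J \<in> Ilam lam n"
  shows "topdeg (phiw J) (mdeg n J) (Pdiag J)" "topdeg (\<lambda>v. - phiw J v) 0 (Pdiag J)"
proof -
  show "topdeg (phiw J) (mdeg n J) (Pdiag J)"
    unfolding Pdiag_eq[OF J] mdeg_def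
  proof (rule topdeg_prod, clarify)
    fix a b assume ab: "(a, b) \<in> noninv n J"
    then have "max 0 (phiw J (Z b) - phiw J (Z a)) = int (blk J b) - int (blk J a)"
      by (auto simp: noninv_def phiw_Z[OF J])
    with topdeg_lin[of "Z a" "Z b" "phiw J"] ab
    show "topdeg (phiw J) (int (blk J b) - int (blk J a)) (lin (Z a) (Z b))"
      by (auto simp: noninv_def)
  qed
  have "topdeg (\<lambda>v. - phiw J v) (\<Sum>(a, b)\<in>noninv n J. 0) (Pdiag J)"
    unfolding Pdiag_eq[OF J]
  proof (rule topdeg_prod, clarify)
    fix a b assume ab: "(a, b) \<in> noninv n J"
    then have "max 0 (- phiw J (Z b) - - phiw J (Z a)) = 0"
      by (auto simp: noninv_def phiw_Z[OF J])
    with topdeg_lin[of "Z a" "Z b" "\<lambda>v. - phiw J v"] ab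
    show "topdeg (\<lambda>v. - phiw J v) 0 (lin (Z a) (Z b))"
      by (auto simp: noninv_def)
  qed
  then show "topdeg (\<lambda>v. - phiw J v) 0 (Pdiag J)" by (simp add: case_prod_unfold)
qed

lemma Jsmall_iff_degle:
  assumes J: "J \<in> Ilam lam n"
  shows "Jsmall J f \<longleftrightarrow> degle (phiw J) (mdeg n J - 1) f \<and> degle (\<lambda>v. - phiw J v) 0 f"
  by (rule Jsmall_iff) (use Ilam_finite[OF J] Ilam_length[OF J] topdeg_Pdiag[OF J] in auto)

text \<open>If the quotient \<open>g\<close> were nonzero, its highest weight would be at most
  \<open>-1\<close> and its lowest weight at least \<open>0\<close>, since the weights of
  \<open>Pdiag J\<close> range exactly from \<open>0\<close> to \<open>mdeg n J\<close>.\<close>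

lemma Pdiag_multiple_small:
  assumes J: "J \<in> Ilam lam n" and "Pdiag J dvd f"
    and "degle (phiw J) (mdeg n J - 1) f" "degle (\<lambda>v. - phiw J v) 0 f"
  shows "f = 0"
proof (rule ccontr)
  assume "f \<noteq> 0"
  from assms(2) obtain g where g: "f = Pdiag J * g" ..
  with \<open>f \<noteq> 0\<close> have "g \<noteq> 0" by auto
  obtain d where d: "topdeg (phiw J) d g" using topdeg_exists[OF \<open>g \<noteq> 0\<close>] .
  obtain d' where d': "topdeg (\<lambda>v. - phiw J v) d' g" using topdeg_exists[OF \<open>g \<noteq> 0\<close>] .
  have "mdeg n J + d \<le> mdeg n J - 1"
    using topdeg_degle[OF topdeg_mult[OF topdeg_Pdiag(1)[OF J] d]] assms(3) unfolding g by blast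
  moreover have "0 + d' \<le> 0"
    using topdeg_degle[OF topdeg_mult[OF topdeg_Pdiag(2)[OF J] d']] assms(4) unfolding g by blast
  moreover from d obtain e where "e \<in> Poly_Mapping.keys g" "wt (phiw J) e = d"
    by (auto simp: topdeg_def)
  then have "- d \<le> d'" using d' by (auto simp: topdeg_def degle_def wt_uminus)
  ultimately show False by simp
qed

section \<open>Fixed points related by an exchange, and uniqueness\<close>

lemma sym_eval:
  assumes F: "symGZ lam n F" and x: "nonzero x" and y: "nonzero y"
    and Z: "\<And>a. a \<in> {1..n} \<Longrightarrow> x (Z a) = y (Z a)"
    and G: "\<And>k. k < length lam \<Longrightarrow>
      \<exists>\<pi>. \<pi> permutes {..<lam!k} \<and> (\<forall>i<lam!k. y (G k i) = x (G k (\<pi> i)))"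
  shows "evalp x F = evalp y F"
proof -
  \<comment> \<open>\<open>symGZ\<close> permits permuting one group of variables at a time, so the
    groups pass from \<open>x\<close> to \<open>y\<close> one after the other: \<open>h m\<close>
    has changed the first \<open>m\<close> of them.\<close>
  define h where "h = (\<lambda>m v. case v of G k i \<Rightarrow> if k < m then y (G k i) else x (G k i) | Z a \<Rightarrow> x (Z a))"
  have vars: "vars F \<subseteq> {G k a | k a. k < length lam \<and> a < lam!k} \<union> {Z a | a. a \<in> {1..n}}"
    using F by (simp add: symGZ_def)
  have "evalp (h m) F = evalp x F" if "m \<le> length lam" for m
    using that
  proof (induction m)
    case 0
    have "h 0 = x" by (auto simp: h_def split: var.splits)
    then show ?case by simp
  next
    case (Suc m)
    then obtain \<pi> where \<pi>: "\<pi> permutes {..<lam!m}" "\<forall>i<lam!m. y (G m i) = x (G m (\<pi> i))"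
      using G[of m] by auto
    define \<rho> where "\<rho> = (\<lambda>v. case v of G l a \<Rightarrow> (if l = m then G l (\<pi> a) else G l a) | Z a \<Rightarrow> Z a)"
    have inv: "rename \<rho> F = F"
      using F \<pi>(1) Suc.prems by (simp add: symGZ_def \<rho>_def)
    have "nonzero (h m)"
      using x y by (auto simp: h_def nonzero_def split: var.splits)
    then have "evalp (h m) F = evalp (\<lambda>v. h m (\<rho> v)) F"
      by (metis evalp_rename inv)
    also have "\<dots> = evalp (h (Suc m)) F"
    proof (rule evalp_cong)
      fix v assume "v \<in> vars F"
      with vars have "(\<exists>k a. v = G k a \<and> k < length lam \<and> a < lam!k) \<or> (\<exists>a. v = Z a)" by auto
      then show "h m (\<rho> v) = h (Suc m) v"
        using \<pi>(2) by (auto simp: h_def \<rho>_def less_Suc_eq)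
    qed
    finally show ?case using Suc by simp
  qed
  from this[of "length lam"] have "evalp x F = evalp (h (length lam)) F" by simp
  also have "\<dots> = evalp y F"
    by (rule evalp_cong) (use vars Z in \<open>auto simp: h_def\<close>)
  finally show ?thesis .
qed

text \<open>Supplies the permutations for \<open>sym_eval\<close>: the sorted lists of a block
  before and after an exchange may list the same values in different orders.\<close>

lemma obtain_permutation_nth:
  assumes "image_mset f (mset xs) = image_mset g (mset ys)"
  obtains \<pi> where "\<pi> permutes {..<length xs}" "\<And>i. i < length xs \<Longrightarrow> g (ys ! i) = f (xs ! \<pi> i)"
proof -
  have "mset (map g ys) = mset (map f xs)" using assms by simp
  then obtain \<pi> where \<pi>: "\<pi> permutes {..<length (map f xs)}" "permute_list \<pi> (map f xs) = map g ys"
    by (rule mset_eq_permutation)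
  have len: "length ys = length xs" using \<pi>(2) by (metis length_map length_permute_list)
  show ?thesis
  proof
    show "\<pi> permutes {..<length xs}" using \<pi>(1) by simp
    fix i assume i: "i < length xs"
    have "map g ys ! i = map f xs ! \<pi> i"
      using \<pi> i permute_list_nth[OF \<pi>(1)] by (metis length_map)
    moreover have "\<pi> i < length xs" using \<pi>(1) i permutes_in_image[OF \<pi>(1), of i] by simp
    ultimately show "g (ys ! i) = f (xs ! \<pi> i)" using i len by simp
  qed
qed

definition swapJ :: "nat \<Rightarrow> nat \<Rightarrow> nat set list \<Rightarrow> nat set list" where
  "swapJ a b J = map (image (transpose a b)) J"

lemma swapJ_Ilam:
  assumes J: "J \<in> Ilam lam n" and "a \<in> {1..n}" "b \<in> {1..n}"
  shows "swapJ a b J \<in> Ilam lam n"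
proof -
  let ?s = "transpose a b"
  have s: "?s ` {1..n} = {1..n}" using assms(2,3) by (simp add: transpose_image_eq)
  have len: "length J = length lam" using Ilam_length[OF J] .
  have "\<Union> (set (swapJ a b J)) = ?s ` \<Union> (set J)" by (auto simp: swapJ_def)
  also have "\<dots> = {1..n}" using J s by (simp add: Ilam_def)
  finally have U: "\<Union> (set (swapJ a b J)) = {1..n}" .
  have "swapJ a b J ! k \<subseteq> {1..n}" "card (swapJ a b J ! k) = lam ! k" if "k < length lam" for k
    using that Ilam_subset[OF J that] s Ilam_card[OF J that]
    by (auto simp: swapJ_def len card_image[OF inj_on_subset[OF inj_transpose]])
  moreover have "swapJ a b J ! k \<inter> swapJ a b J ! l = {}" if "k < l \<and> l < length lam" for k l
  proof -
    have "J ! k \<inter> J ! l = {}" using Ilam_disjoint[OF J, of k l] that by auto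
    then have "?s ` (J ! k) \<inter> ?s ` (J ! l) = {}" by (simp flip: image_Int)
    then show ?thesis using that by (simp add: swapJ_def len)
  qed
  ultimately show ?thesis using U by (auto simp: Ilam_def) (simp_all add: swapJ_def len)
qed

lemma blk_swapJ:
  assumes J: "J \<in> Ilam lam n" and "a \<in> {1..n}" "b \<in> {1..n}" "c \<in> {1..n}"
  shows "blk (swapJ a b J) c = blk J (transpose a b c)"
proof (rule blk_eqI[OF swapJ_Ilam[OF assms(1-3)]])
  have "transpose a b c \<in> {1..n}" using assms(2-4) by (auto simp: transpose_def)
  note * = blk_props[OF J this]
  show "blk J (transpose a b c) < length lam" by (rule *)
  have "c = transpose a b (transpose a b c)" by simp
  with *(2) have "c \<in> transpose a b ` (J ! blk J (transpose a b c))" by blast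
  with *(1) show "c \<in> swapJ a b J ! blk J (transpose a b c)"
    by (simp add: swapJ_def Ilam_length[OF J])
qed

text \<open>On the diagonal \<open>z_a = z_b\<close> both partitions substitute the same multiset of
  values into each group, and \<open>F\<close> is symmetric in each group.\<close>

lemma restr_swapJ:
  assumes F: "symGZ lam n F" and J: "J \<in> Ilam lam n" and ab: "a \<in> {1..n}" "b \<in> {1..n}"
  shows "rename (merge (Z a) (Z b)) (restr (swapJ a b J) F) = rename (merge (Z a) (Z b)) (restr J F)"
proof (rule lpoly_eqI[of "{}"])
  fix x assume "gen {} x"
  then have x: "nonzero x" by (simp add: gen_def)
  define g where "g = (\<lambda>c. x (merge (Z a) (Z b) (Z c)))"
  define y where "y = (\<lambda>J v. case v of G k i \<Rightarrow> g (sorted_list_of_set (J!k) ! i) | Z c \<Rightarrow> g c)"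
  have ev: "evalp x (rename (merge (Z a) (Z b)) (restr J F)) = evalp (y J) F" for J
  proof -
    have "nonzero (\<lambda>v. x (merge (Z a) (Z b) v))" using x by (auto simp: nonzero_def)
    then have "evalp x (rename (merge (Z a) (Z b)) (restr J F)) =
      evalp (\<lambda>v. x (merge (Z a) (Z b) (case v of G k a \<Rightarrow> Z (sorted_list_of_set (J ! k) ! a) | Z a \<Rightarrow> Z a))) F"
      unfolding restr_def using x by (simp add: evalp_rename)
    also have "\<dots> = evalp (y J) F"
      by (rule arg_cong2[of _ _ _ _ evalp]) (auto simp: y_def g_def split: var.splits)
    finally show ?thesis .
  qed
  have nz: "nonzero (y J)" for J
    using x by (auto simp: nonzero_def y_def g_def split: var.splits)
  have "evalp (y J) F = evalp (y (swapJ a b J)) F"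
  proof (rule sym_eval[OF F nz nz])
    fix k assume k: "k < length lam"
    have fin: "finite (J ! k)" using Ilam_finite[OF J k] .
    have sk: "swapJ a b J ! k = transpose a b ` (J ! k)"
      using k by (simp add: swapJ_def Ilam_length[OF J])
    have gs: "g (transpose a b c) = g c" for c
      by (auto simp: g_def merge_def transpose_def)
    have "image_mset g (mset (sorted_list_of_set (swapJ a b J ! k)))
        = image_mset g (image_mset (transpose a b) (mset_set (J ! k)))"
      by (simp add: sk image_mset_mset_set flip: sorted_list_of_mset_set)
    also have "\<dots> = image_mset g (mset (sorted_list_of_set (J ! k)))"
      by (simp add: multiset.map_comp o_def gs flip: sorted_list_of_mset_set)
    finally have *: "image_mset g (mset (sorted_list_of_set (J ! k)))
      = image_mset g (mset (sorted_list_of_set (swapJ a b J ! k)))" by simp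
    have len: "length (sorted_list_of_set (J ! k)) = lam ! k"
      using Ilam_card[OF J k] by simp
    show "\<exists>\<pi>. \<pi> permutes {..<lam!k} \<and> (\<forall>i<lam!k. y (swapJ a b J) (G k i) = y J (G k (\<pi> i)))"
      using obtain_permutation_nth[OF *] unfolding len y_def var.case by metis
  qed (simp add: y_def)
  then show "evalp x (rename (merge (Z a) (Z b)) (restr (swapJ a b J) F))
    = evalp x (rename (merge (Z a) (Z b)) (restr J F))"
    by (simp add: ev)
qed simp

text \<open>The bounds are on the difference of the two classes, so that the partition
  \<open>I\<close>, where the restrictions agree and the difference is \<open>0\<close>, is covered
  as well.\<close>

lemma restr_unique:
  assumes F: "symGZ lam n F" "symGZ lam n F'"
    and small: "\<And>J. J \<in> Ilam lam n \<Longrightarrow> degle (phiw J) (mdeg n J - 1) (restr J F - restr J F')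
      \<and> degle (\<lambda>v. - phiw J v) 0 (restr J F - restr J F')"
    and "J \<in> Ilam lam n"
  shows "restr J F = restr J F'"
  using assms(4)
proof (induction "\<Sum>c\<in>{1..n}. c * blk J c" arbitrary: J rule: less_induct)
  case less
  note J = less.prems
  let ?d = "restr J F - restr J F'"
  have "lin (Z a) (Z b) ^ 1 dvd ?d" if ab: "(a, b) \<in> noninv n J" for a b
  proof -
    have *: "a \<in> {1..n}" "b \<in> {1..n}" "a < b" "blk J a < blk J b" using ab by (auto simp: noninv_def)
    let ?J = "swapJ a b J"
    have "(\<Sum>c\<in>{1..n}. c * blk ?J c) = (\<Sum>c\<in>{1..n}. c * blk J (transpose a b c))"
      by (rule sum.cong) (auto simp: blk_swapJ[OF J *(1,2)])
    also have "\<dots> = a * blk J b + b * blk J a + (\<Sum>c\<in>{1..n} - {a} - {b}. c * blk J (transpose a b c))"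
      using * by (simp add: sum.remove[of _ a] sum.remove[of _ b])
    also have "(\<Sum>c\<in>{1..n} - {a} - {b}. c * blk J (transpose a b c)) = (\<Sum>c\<in>{1..n} - {a} - {b}. c * blk J c)"
      by (rule sum.cong) auto
    also have "a * blk J b + b * blk J a + (\<Sum>c\<in>{1..n} - {a} - {b}. c * blk J c)
      < a * blk J a + b * blk J b + (\<Sum>c\<in>{1..n} - {a} - {b}. c * blk J c)"
    \<comment> \<open>The two sides differ by \<open>(b - a) * (blk J b - blk J a)\<close>; the
      positive \<open>i\<close> and \<open>j\<close> express this without subtraction of natural
      numbers.\<close>
    proof -
      obtain i j where "b = a + i" "i > 0" "blk J b = blk J a + j" "j > 0"
        using *(3,4) by (metis less_imp_add_positive)
      then show ?thesis by (simp add: algebra_simps)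
    qed
    also have "\<dots> = (\<Sum>c\<in>{1..n}. c * blk J c)"
      using * by (simp add: sum.remove[of _ a] sum.remove[of _ b])
    finally have "restr ?J F = restr ?J F'"
      using less.hyps swapJ_Ilam[OF J *(1,2)] by blast
    then have "rename (merge (Z a) (Z b)) (restr J F) = rename (merge (Z a) (Z b)) (restr J F')"
      using restr_swapJ[OF F(1) J *(1,2)] restr_swapJ[OF F(2) J *(1,2)] by simp
    then show ?thesis by (simp add: lin_dvd_iff rename_diff)
  qed
  then have "(\<Prod>(u, v)\<in>map_prod Z Z ` noninv n J. lin u v ^ 1) dvd ?d"
    by (intro prod_lin_power_dvd finite_imageI finite_noninv) (auto simp: noninv_def doubleton_eq_iff)
  also have "(\<Prod>(u, v)\<in>map_prod Z Z ` noninv n J. lin u v ^ 1) = Pdiag J"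
    unfolding Pdiag_eq[OF J]
    by (subst prod.reindex) (auto simp: inj_on_def case_prod_unfold)
  finally have "?d = 0"
    using Pdiag_multiple_small[OF J] small[OF J] by blast
  then show ?case by simp
qed

section \<open>The weight function as a Laurent polynomial\<close>

lemma lpoly_eqI_nonzero: "(\<And>x. nonzero x \<Longrightarrow> evalp x f = evalp x g) \<Longrightarrow> f = g"
  by (rule lpoly_eqI[of "{}"]) (auto simp: gen_def)

text \<open>Write \<open>R = lin u v * g\<close>. Exchanging \<open>u\<close> and \<open>v\<close>
  multiplies \<open>lin u v\<close> by \<open>- u/v\<close>, so symmetry of \<open>R\<close> forces
  \<open>g\<close> to equal its own negative on the diagonal; thus \<open>g\<close> vanishes there
  too.\<close>

lemma lin_square_dvd:
  assumes "u \<noteq> v" and sym: "rename (transpose u v) R = R" and van: "rename (merge u v) R = 0"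
  shows "lin u v ^ 2 dvd R"
proof -
  from van have "lin u v dvd R" by (simp add: lin_dvd_iff)
  then obtain g where g: "R = lin u v * g" ..
  have "lin v u = - (Xp u 1 * Xp v (-1)) * lin u v"
    by (rule lpoly_eqI_nonzero)
      (simp add: evalp_lin evalp_mult evalp_uminus power_int_minus, simp add: nonzero_def field_simps)
  then have "lin u v * g = lin u v * (- (Xp u 1 * Xp v (-1)) * rename (transpose u v) g)"
    using sym by (simp add: g rename_mult rename_lin mult_ac)
  then have *: "g = - (Xp u 1 * Xp v (-1)) * rename (transpose u v) g"
    using lin_nonzero[OF assms(1)] mult_left_cancel by blast
  have "rename (merge u v) g = 0"
  proof (rule lpoly_eqI_nonzero)
    fix x assume x: "nonzero x"
    define y where "y = (\<lambda>w. x (merge u v w))"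
    have y: "nonzero y" using x by (auto simp: y_def nonzero_def)
    have yt: "(\<lambda>w. y (transpose u v w)) = y"
      by (auto simp: y_def merge_def transpose_def fun_eq_iff)
    have "evalp y g = evalp y (- (Xp u 1 * Xp v (-1)) * rename (transpose u v) g)"
      using * by (rule arg_cong)
    also have "\<dots> = - (y u / y v) * evalp y g"
      using y by (simp add: evalp_mult evalp_uminus evalp_rename yt power_int_minus divide_inverse)
    also have "y u / y v = 1"
      using x by (simp add: y_def merge_def nonzero_def)
    finally have "evalp y g = 0" by simp
    then show "evalp x (rename (merge u v) g) = evalp x 0"
      using x by (simp add: evalp_rename y_def)
  qed
  then have "lin u v dvd g" by (simp add: lin_dvd_iff)
  then show ?thesis by (simp add: g power2_eq_square mult_dvd_mono)
qed

definition Wsum :: "nat list \<Rightarrow> nat set list \<Rightarrow> (nat \<Rightarrow> nat \<Rightarrow> complex) \<Rightarrow> complex" where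
  "Wsum lam I t = (\<Sum>\<sigma>\<in>symperms lam. Uval lam I 0 (\<lambda>k a. t k (\<sigma> k a)))"

text \<open>At \<open>h = 0\<close> the power of \<open>1 - h\<close> is \<open>1\<close>.
  \<open>Wsum\<close> keeps the variables of all levels free, so it can be studied before the
  substitution of \<open>z_J\<close>.\<close>

lemma Wval_eq_Wsum: "Wval lam I J 0 z = Wsum lam I (\<lambda>k a. z (idx J k a))"
  by (simp add: Wval_def Wsum_def)

lemma Uval_cong:
  assumes "\<And>k a. 1 \<le> k \<Longrightarrow> k \<le> length lam \<Longrightarrow> a < lev lam k \<Longrightarrow> t k a = t' k a"
  shows "Uval lam I h t = Uval lam I h t'"
  unfolding Uval_def
  by (intro prod.cong refl arg_cong2[where f = "(*)"] arg_cong2[where f = "(/)"]) (auto simp: assms)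

lemma symperms_less:
  assumes "\<sigma> \<in> symperms lam" "a < lev lam k"
  shows "\<sigma> k a < lev lam k"
proof (cases "k \<in> {1..<length lam}")
  case True
  then have "\<sigma> k permutes {..<lev lam k}" using assms(1) by (simp add: symperms_def)
  then show ?thesis using permutes_in_image[of "\<sigma> k" "{..<lev lam k}" a] assms(2) by simp
next
  case False
  then show ?thesis using assms by (simp add: symperms_def)
qed

lemma symperms_permutes:
  assumes "\<sigma> \<in> symperms lam"
  shows "\<sigma> k permutes {..<lev lam k}"
  using assms by (cases "k \<in> {1..<length lam}") (auto simp: symperms_def permutes_id)

lemma Wsum_cong:
  assumes "\<And>k a. 1 \<le> k \<Longrightarrow> k \<le> length lam \<Longrightarrow> a < lev lam k \<Longrightarrow> t k a = t' k a"
  shows "Wsum lam I t = Wsum lam I t'"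
  unfolding Wsum_def
  by (intro sum.cong refl Uval_cong assms) (auto intro: symperms_less)

lemma finite_symperms: "finite (symperms lam)"
proof (rule finite_subset)
  let ?A = "{1..<length lam}"
  let ?P = "PiE ?A (\<lambda>k. {p. p permutes {..<lev lam k}})"
  show "finite ((\<lambda>f k. if k \<in> ?A then f k else id) ` ?P)"
    by (intro finite_imageI finite_PiE) (auto intro: finite_permutations)
  show "symperms lam \<subseteq> (\<lambda>f k. if k \<in> ?A then f k else id) ` ?P"
  proof
    fix \<sigma> assume s: "\<sigma> \<in> symperms lam"
    show "\<sigma> \<in> (\<lambda>f k. if k \<in> ?A then f k else id) ` ?P"
    proof (rule image_eqI[of _ _ "restrict \<sigma> ?A"])
      show "\<sigma> = (\<lambda>k. if k \<in> ?A then restrict \<sigma> ?A k else id)"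
        using s by (auto simp: symperms_def fun_eq_iff)
      show "restrict \<sigma> ?A \<in> ?P"
        using s by (auto simp: symperms_def)
    qed
  qed
qed

text \<open>Stated for an arbitrary \<open>f\<close> because the symmetrizations of both
  \<open>Uval\<close> and \<open>Avals\<close> are needed.\<close>

lemma sum_symperms_shift:
  assumes \<tau>: "\<tau> \<in> symperms lam"
  shows "(\<Sum>\<sigma>\<in>symperms lam. f (\<lambda>k a. t k (\<tau> k (\<sigma> k a)))) = (\<Sum>\<sigma>\<in>symperms lam. f (\<lambda>k a. t k (\<sigma> k a)))"
proof (rule sum.reindex_bij_witness[of _ "\<lambda>\<sigma> k a. inv (\<tau> k) (\<sigma> k a)" "\<lambda>\<sigma> k a. \<tau> k (\<sigma> k a)"])
  note bij = permutes_bij[OF symperms_permutes[OF \<tau>]]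
  fix \<sigma> assume \<sigma>: "\<sigma> \<in> symperms lam"
  show "(\<lambda>k a. inv (\<tau> k) (\<tau> k (\<sigma> k a))) = \<sigma>"
    by (intro ext) (simp add: bij_is_inj[OF bij])
  show "(\<lambda>k a. \<tau> k (inv (\<tau> k) (\<sigma> k a))) = \<sigma>"
    by (intro ext) (simp add: bij_is_surj[OF bij] surj_f_inv_f)
  show "(\<lambda>k a. \<tau> k (\<sigma> k a)) \<in> symperms lam"
    using \<sigma> \<tau> permutes_compose[OF symperms_permutes[OF \<sigma>] symperms_permutes[OF \<tau>]]
    by (auto simp: symperms_def o_def fun_eq_iff)
  have "inv (\<tau> k) = id" if "k \<notin> {1..<length lam}" for k
    using that \<tau> by (simp add: symperms_def)
  then show "(\<lambda>k a. inv (\<tau> k) (\<sigma> k a)) \<in> symperms lam"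
    using \<sigma> permutes_compose[OF symperms_permutes[OF \<sigma>] permutes_inv[OF symperms_permutes[OF \<tau>]]]
    by (auto simp: symperms_def o_def fun_eq_iff)
qed simp

text \<open>Two enumerations of the same set differ by a permutation, which the symmetrization
  absorbs. The top level is not symmetrized, so there the values themselves must agree.\<close>

lemma Wsum_same_levels:
  assumes q: "\<And>k. k \<in> {1..<length lam} \<Longrightarrow> bij_betw (q k) {..<lev lam k} (C k)"
    and q': "\<And>k. k \<in> {1..<length lam} \<Longrightarrow> bij_betw (q' k) {..<lev lam k} (C k)"
    and top: "\<And>a. a < lev lam (length lam) \<Longrightarrow> z (q (length lam) a) = z (q' (length lam) a)"
  shows "Wsum lam I (\<lambda>k a. z (q k a)) = Wsum lam I (\<lambda>k a. z (q' k a))"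
proof -
  \<comment> \<open>On each symmetrized level, \<open>q'\<close> followed by the inverse of
    \<open>q\<close>, extended by the identity.\<close>
  define \<tau> where "\<tau> = (\<lambda>k a. if k \<in> {1..<length lam} \<and> a < lev lam k
      then inv_into {..<lev lam k} (q k) (q' k a) else a)"
  have perm: "\<tau> k permutes {..<lev lam k}" if k: "k \<in> {1..<length lam}" for k
  proof (rule bij_imp_permutes)
    have "bij_betw (inv_into {..<lev lam k} (q k) \<circ> q' k) {..<lev lam k} {..<lev lam k}"
      using bij_betw_trans[OF q'[OF k] bij_betw_inv_into[OF q[OF k]]] .
    then show "bij_betw (\<tau> k) {..<lev lam k} {..<lev lam k}"
      by (rule bij_betw_cong[THEN iffD1, rotated]) (use k in \<open>auto simp: \<tau>_def\<close>)
  qed (simp add: \<tau>_def)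
  have \<tau>: "\<tau> \<in> symperms lam"
    using perm by (auto simp: symperms_def \<tau>_def fun_eq_iff)
  have "Wsum lam I (\<lambda>k a. z (q' k a)) = Wsum lam I (\<lambda>k a. z (q k (\<tau> k a)))"
  proof (rule Wsum_cong)
    fix k a assume k: "1 \<le> k" "k \<le> length lam" "a < lev lam k"
    show "z (q' k a) = z (q k (\<tau> k a))"
    proof (cases "k = length lam")
      case True
      then show ?thesis using top k by (simp add: \<tau>_def)
    next
      case False
      with k have k': "k \<in> {1..<length lam}" by simp
      have "q' k a \<in> q k ` {..<lev lam k}"
        using bij_betwE[OF q'[OF k']] k(3) bij_betw_imp_surj_on[OF q[OF k']] by auto
      then have "q k (inv_into {..<lev lam k} (q k) (q' k a)) = q' k a"
        by (rule f_inv_into_f)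
      then show ?thesis using k' k by (simp add: \<tau>_def)
    qed
  qed
  also have "\<dots> = Wsum lam I (\<lambda>k a. z (q k a))"
    unfolding Wsum_def using sum_symperms_shift[OF \<tau>, of "Uval lam I 0" "\<lambda>k a. z (q k a)"] by simp
  finally show ?thesis by simp
qed

text \<open>With \<open>Avals\<close> and \<open>Ovals\<close> the rational function \<open>U\<^sub>I\<close> at \<open>h = 0\<close> is \<open>Avals / Ovals\<close>, where
  the denominator runs over all ordered pairs and is therefore invariant under permutations.\<close>

definition Avals :: "nat list \<Rightarrow> nat set list \<Rightarrow> (nat \<Rightarrow> nat \<Rightarrow> complex) \<Rightarrow> complex" where
  "Avals lam I t = (\<Prod>k\<in>{1..<length lam}. \<Prod>a<lev lam k.
     (\<Prod>c\<in>{c. c < lev lam (Suc k) \<and> idx I (Suc k) c > idx I k a}. 1 - t (Suc k) c / t k a)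
   * (\<Prod>b<a. 1 - t k b / t k a))"

definition Ovals :: "nat list \<Rightarrow> (nat \<Rightarrow> nat \<Rightarrow> complex) \<Rightarrow> complex" where
  "Ovals lam t = (\<Prod>k\<in>{1..<length lam}. \<Prod>a<lev lam k. \<Prod>b\<in>{..<lev lam k} - {a}. 1 - t k b / t k a)"

definition level_inj :: "nat list \<Rightarrow> (nat \<Rightarrow> nat \<Rightarrow> complex) \<Rightarrow> bool" where
  "level_inj lam t \<longleftrightarrow> (\<forall>k\<in>{1..<length lam}. inj_on (t k) {..<lev lam k} \<and> (\<forall>a<lev lam k. t k a \<noteq> 0))"

lemma level_inj_factor:
  assumes "level_inj lam t" "k \<in> {1..<length lam}" "a < lev lam k" "b < lev lam k" "a \<noteq> b"
  shows "1 - t k b / t k a \<noteq> 0"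
proof -
  have "t k a \<noteq> t k b" "t k a \<noteq> 0" using assms by (auto simp: level_inj_def inj_on_def)
  then show ?thesis by (simp add: field_simps)
qed

lemma Ovals_nonzero: "level_inj lam t \<Longrightarrow> Ovals lam t \<noteq> 0"
  unfolding Ovals_def using level_inj_factor by (auto simp del: right_minus_eq)

text \<open>At \<open>h = 0\<close> the first product and the numerators of the third are
  \<open>1\<close>. The denominators, over \<open>b > a\<close>, cancel that half of
  \<open>Ovals\<close>; the half \<open>b < a\<close> remains in \<open>Avals\<close>.\<close>

lemma Uval_Ovals:
  assumes "level_inj lam t"
  shows "Uval lam I 0 t * Ovals lam t = Avals lam I t"
  unfolding Uval_def Ovals_def Avals_def prod.distrib[symmetric]
proof (intro prod.cong refl)
  fix k a assume k: "k \<in> {1..<length lam}" and a: "a \<in> {..<lev lam k}"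
  have nz: "(\<Prod>b\<in>{a<..<lev lam k}. 1 - t k b / t k a) \<noteq> 0"
    using level_inj_factor[OF assms k] a by (auto simp del: right_minus_eq)
  have split: "{..<lev lam k} - {a} = {..<a} \<union> {a<..<lev lam k}" using a by auto
  have "(\<Prod>b\<in>{..<lev lam k} - {a}. 1 - t k b / t k a)
    = (\<Prod>b<a. 1 - t k b / t k a) * (\<Prod>b\<in>{a<..<lev lam k}. 1 - t k b / t k a)"
    unfolding split by (rule prod.union_disjoint) auto
  then show "(\<Prod>c\<in>{c. c < lev lam (Suc k) \<and> idx I (Suc k) c < idx I k a}. 1 - 0 * t (Suc k) c / t k a) *
       (\<Prod>c\<in>{c. c < lev lam (Suc k) \<and> idx I k a < idx I (Suc k) c}. 1 - t (Suc k) c / t k a) *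
       (\<Prod>b\<in>{a<..<lev lam k}. (1 - 0 * t k b / t k a) / (1 - t k b / t k a)) *
       (\<Prod>b\<in>{..<lev lam k} - {a}. 1 - t k b / t k a) =
       (\<Prod>c\<in>{c. c < lev lam (Suc k) \<and> idx I k a < idx I (Suc k) c}. 1 - t (Suc k) c / t k a) *
       (\<Prod>b<a. 1 - t k b / t k a)"
    using nz by (simp add: prod_dividef del: prod_zero_iff)
qed

lemma prod_offdiag_reindex:
  assumes "bij_betw q A B"
  shows "(\<Prod>a\<in>A. \<Prod>b\<in>A - {a}. f (q a) (q b)) = (\<Prod>a\<in>B. \<Prod>b\<in>B - {a}. f a b)"
proof -
  have "(\<Prod>b\<in>A - {a}. f (q a) (q b)) = (\<Prod>b\<in>B - {q a}. f (q a) b)" if "a \<in> A" for a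
    by (rule prod.reindex_bij_betw) (use assms that in \<open>auto simp: bij_betw_def inj_on_def\<close>)
  then have "(\<Prod>a\<in>A. \<Prod>b\<in>A - {a}. f (q a) (q b)) = (\<Prod>a\<in>A. \<Prod>b\<in>B - {q a}. f (q a) b)"
    by simp
  also have "\<dots> = (\<Prod>a\<in>B. \<Prod>b\<in>B - {a}. f a b)"
    by (rule prod.reindex_bij_betw[OF assms])
  finally show ?thesis .
qed

lemma Ovals_symperms:
  assumes "\<sigma> \<in> symperms lam"
  shows "Ovals lam (\<lambda>k a. t k (\<sigma> k a)) = Ovals lam t"
  unfolding Ovals_def
  by (intro prod.cong refl prod_offdiag_reindex[where f = "\<lambda>a b. 1 - t _ b / t _ a"]
      permutes_imp_bij symperms_permutes[OF assms])

lemma level_inj_symperms: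
  assumes "\<sigma> \<in> symperms lam" "level_inj lam t"
  shows "level_inj lam (\<lambda>k a. t k (\<sigma> k a))"
  unfolding level_inj_def
proof (intro ballI conjI allI impI)
  fix k assume k: "k \<in> {1..<length lam}"
  have "inj_on (t k) {..<lev lam k}" using assms(2) k by (simp add: level_inj_def)
  then show "inj_on (\<lambda>a. t k (\<sigma> k a)) {..<lev lam k}"
    using permutes_imp_bij[OF symperms_permutes[OF assms(1), of k]]
    comp_inj_on[of "\<sigma> k" "{..<lev lam k}" "t k"] by (simp add: bij_betw_def o_def)
  fix a assume "a < lev lam k"
  then show "t k (\<sigma> k a) \<noteq> 0"
    using assms(2) k symperms_less[OF assms(1)] by (simp add: level_inj_def)
qed

lemma Wsum_Ovals:
  assumes "level_inj lam t"
  shows "Wsum lam I t * Ovals lam t = (\<Sum>\<sigma>\<in>symperms lam. Avals lam I (\<lambda>k a. t k (\<sigma> k a)))"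
  unfolding Wsum_def sum_distrib_right
proof (rule sum.cong[OF refl])
  fix \<sigma> assume \<sigma>: "\<sigma> \<in> symperms lam"
  show "Uval lam I 0 (\<lambda>k a. t k (\<sigma> k a)) * Ovals lam t = Avals lam I (\<lambda>k a. t k (\<sigma> k a))"
    using Uval_Ovals[OF level_inj_symperms[OF \<sigma> assms]] by (simp add: Ovals_symperms[OF \<sigma>])
qed

lemma prod_offdiag_pairs:
  "(\<Prod>a<m. \<Prod>b\<in>{..<m} - {a}. f a b) = (\<Prod>a<m. \<Prod>b<a. f a b * f b a)" for m :: nat
proof (induction m)
  case (Suc m)
  have "(\<Prod>b\<in>{..<Suc m} - {a}. f a b) = f a m * (\<Prod>b\<in>{..<m} - {a}. f a b)" if "a < m" for a
  proof -
    have "{..<Suc m} - {a} = insert m ({..<m} - {a})" using that by auto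
    then show ?thesis by simp
  qed
  moreover have "{..<Suc m} - {m} = {..<m}" by auto
  ultimately show ?case using Suc by (simp add: prod.distrib mult_ac)
qed simp

text \<open>The variables of the weight function. Below the top level, \<open>G k a\<close> serves
  here as a name for the \<open>(a+1)\<close>-st variable of level \<open>k\<close>, not for a
  \<open>gamma\<close>; the variables \<open>gamma\<close> enter in
  \<open>restr_lpoly\<close>.\<close>

definition tv :: "nat list \<Rightarrow> nat \<Rightarrow> nat \<Rightarrow> var" where
  "tv lam k a = (if k < length lam then G k a else Z (Suc a))"

lemma Wsum_lpoly:
  obtains P where "\<And>x. nonzero x \<Longrightarrow> level_inj lam (\<lambda>k a. x (tv lam k a)) \<Longrightarrow>
    evalp x P = Wsum lam I (\<lambda>k a. x (tv lam k a))"
proof -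
  let ?K = "{1..<length lam}"
  \<comment> \<open>The polynomial form of \<open>Avals\<close> for one summand. The sum
    \<open>R\<close> equals \<open>Wsum\<close> times \<open>Ovals\<close> where the denominators
    are nonzero, and is defined on the whole torus.\<close>
  define A where "A = (\<lambda>\<sigma>. \<Prod>k\<in>?K. \<Prod>a<lev lam k.
     (\<Prod>c\<in>{c. c < lev lam (Suc k) \<and> idx I (Suc k) c > idx I k a}.
        lin (tv lam k (\<sigma> k a)) (tv lam (Suc k) (\<sigma> (Suc k) c)))
   * (\<Prod>b<a. lin (tv lam k (\<sigma> k a)) (tv lam k (\<sigma> k b))))"
  define R where "R = sum A (symperms lam)"
  have evR: "evalp x R = (\<Sum>\<sigma>\<in>symperms lam. Avals lam I (\<lambda>k a. x (tv lam k (\<sigma> k a))))"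
    if "nonzero x" for x
    using that by (simp add: R_def evalp_sum A_def Avals_def evalp_prod evalp_mult evalp_lin)
  \<comment> \<open>Each unordered pair of variables of a level once: the square of its factor
    accounts for both ordered pairs in \<open>Ovals\<close>.\<close>
  define S where "S = (SIGMA k:?K. SIGMA a:{..<lev lam k}. {..<a})"
  define e where "e = (\<lambda>(k, a, b). (G k b, G k a))"
  have fin: "finite S" unfolding S_def by auto
  have "lin (G k b) (G k a) ^ 2 dvd R" if kab: "k \<in> ?K" "a < lev lam k" "b < a" for k a b
  proof (rule lin_square_dvd)
    show "G k b \<noteq> G k a" using kab by simp
    show "rename (transpose (G k b) (G k a)) R = R"
    proof (rule lpoly_eqI_nonzero)
      fix x assume x: "nonzero x"
      define \<tau> where "\<tau> = (\<lambda>k'. if k' = k then transpose b a else id)"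
      have \<tau>: "\<tau> \<in> symperms lam"
        using kab by (auto simp: symperms_def \<tau>_def permutes_swap_id permutes_id)
      have tr: "transpose (G k b) (G k a) (tv lam k' c) = tv lam k' (\<tau> k' c)" for k' c
        using kab by (auto simp: tv_def \<tau>_def transpose_def)
      have "nonzero (\<lambda>v. x (transpose (G k b) (G k a) v))" using x by (simp add: nonzero_def)
      then show "evalp x (rename (transpose (G k b) (G k a)) R) = evalp x R"
        using x sum_symperms_shift[OF \<tau>, of "Avals lam I" "\<lambda>k a. x (tv lam k a)"]
        by (simp add: evalp_rename evR tr)
    qed
    show "rename (merge (G k b) (G k a)) R = 0"
    proof (rule lpoly_eqI_nonzero)
      fix x assume x: "nonzero x"
      define y where "y = (\<lambda>v. x (merge (G k b) (G k a) v))"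
      have y: "nonzero y" using x by (simp add: nonzero_def y_def)
      have yeq: "y (G k a) = y (G k b)" by (simp add: y_def merge_def)
      have "Avals lam I (\<lambda>k a. y (tv lam k (\<sigma> k a))) = 0" if \<sigma>: "\<sigma> \<in> symperms lam" for \<sigma>
      proof -
        note p = symperms_permutes[OF \<sigma>, of k]
        define a0 b0 where "a0 = inv (\<sigma> k) a" and "b0 = inv (\<sigma> k) b"
        have *: "a0 < lev lam k" "b0 < lev lam k" "\<sigma> k a0 = a" "\<sigma> k b0 = b"
          using permutes_in_image[OF permutes_inv[OF p], of a] permutes_in_image[OF permutes_inv[OF p], of b]
            permutes_inverses(1)[OF p] kab by (auto simp: a0_def b0_def)
        \<comment> \<open>\<open>Avals\<close> has a factor only for the later position against the
          earlier one, so the two positions are put in order.\<close>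
        define a' b' where "a' = max a0 b0" and "b' = min a0 b0"
        have "a0 \<noteq> b0" using * kab by auto
        then have ab': "a' < lev lam k" "b' < a'" using * by (auto simp: a'_def b'_def)
        have "y (tv lam k (\<sigma> k a')) = y (tv lam k (\<sigma> k b'))"
          using kab yeq * by (auto simp: a'_def b'_def tv_def max_def min_def)
        then have "1 - y (tv lam k (\<sigma> k b')) / y (tv lam k (\<sigma> k a')) = 0"
          using y by (simp add: nonzero_def)
        then have "(\<Prod>b<a'. 1 - y (tv lam k (\<sigma> k b)) / y (tv lam k (\<sigma> k a'))) = 0"
          using ab' by (intro prod_zero) (auto simp del: right_minus_eq)
        then show ?thesis
          unfolding Avals_def using kab(1) ab'
          by (intro prod_zero bexI[of _ k] bexI[of _ a']) (auto simp del: right_minus_eq prod_zero_iff)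
      qed
      then have "evalp y R = 0" using y by (simp add: evR)
      then show "evalp x (rename (merge (G k b) (G k a)) R) = evalp x 0"
        using x by (simp add: evalp_rename y_def)
    qed
  qed
  then have "(\<Prod>(u, v)\<in>e ` S. lin u v ^ 2) dvd R"
    by (intro prod_lin_power_dvd finite_imageI fin) (auto simp: e_def S_def doubleton_eq_iff)
  also have "(\<Prod>(u, v)\<in>e ` S. lin u v ^ 2) = (\<Prod>(k, a, b)\<in>S. lin (G k b) (G k a) ^ 2)"
    by (subst prod.reindex) (auto simp: inj_on_def e_def case_prod_unfold)
  also have "\<dots> = (\<Prod>k\<in>?K. \<Prod>a<lev lam k. \<Prod>b<a. lin (G k b) (G k a) ^ 2)"
    unfolding S_def by (simp add: prod.Sigma)
  finally obtain P' where P': "R = (\<Prod>k\<in>?K. \<Prod>a<lev lam k. \<Prod>b<a. lin (G k b) (G k a) ^ 2) * P'" ..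
  \<comment> \<open>The unit relating the squares to \<open>Ovals\<close>: with
    \<open>r = t_a/t_b\<close>, \<open>(1 - r)^2 = - r * (1 - 1/r) * (1 - r)\<close>.\<close>
  define U where "U = (\<Prod>k\<in>?K. \<Prod>a<lev lam k. \<Prod>b<a. - (Xp (G k a) 1 * Xp (G k b) (-1)))"
  show ?thesis
  proof (rule that[of "U * P'"])
    fix x assume x: "nonzero x" and inj: "level_inj lam (\<lambda>k a. x (tv lam k a))"
    let ?t = "\<lambda>k a. x (tv lam k a)"
    have evU: "evalp x U = (\<Prod>k\<in>?K. \<Prod>a<lev lam k. \<Prod>b<a. - (?t k a / ?t k b))"
      using x by (simp add: U_def evalp_prod evalp_uminus evalp_mult tv_def power_int_minus divide_inverse)
    have "evalp x (\<Prod>k\<in>?K. \<Prod>a<lev lam k. \<Prod>b<a. lin (G k b) (G k a) ^ 2)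
      = (\<Prod>k\<in>?K. \<Prod>a<lev lam k. \<Prod>b<a. (1 - ?t k a / ?t k b) ^ 2)"
      using x by (simp add: evalp_prod evalp_power evalp_lin tv_def)
    also have "\<dots> = (\<Prod>k\<in>?K. \<Prod>a<lev lam k. \<Prod>b<a.
        (- (?t k a / ?t k b)) * ((1 - ?t k b / ?t k a) * (1 - ?t k a / ?t k b)))"
      using x by (intro prod.cong refl) (simp add: nonzero_def field_simps power2_eq_square)
    also have "\<dots> = evalp x U * Ovals lam ?t"
      by (simp only: evU Ovals_def prod_offdiag_pairs prod.distrib)
    finally have "evalp x R = evalp x (U * P') * Ovals lam ?t"
      using x by (simp add: P' evalp_mult)
    moreover have "evalp x R = Wsum lam I ?t * Ovals lam ?t"
      using Wsum_Ovals[OF inj] evR[OF x] by simp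
    ultimately show "evalp x (U * P') = Wsum lam I ?t"
      using Ovals_nonzero[OF inj] by simp
  qed
qed

section \<open>Restriction to the fixed points\<close>

definition Blk :: "nat set list \<Rightarrow> nat \<Rightarrow> nat set" where
  "Blk J k = \<Union> (set (take k J))"

lemma Blk_eq:
  assumes J: "J \<in> Ilam lam n" and k: "k \<le> length lam"
  shows "Blk J k = {a \<in> {1..n}. blk J a < k}"
proof -
  have "a \<in> Blk J k \<longleftrightarrow> (\<exists>j<k. a \<in> J ! j)" for a
    using k Ilam_length[OF J] by (auto simp: Blk_def simp flip: nth_image)
  moreover have "(\<exists>j<k. a \<in> J ! j) \<longleftrightarrow> a \<in> {1..n} \<and> blk J a < k" for a
    using mem_block_iff[OF J, of _ a] k by (auto intro: exI[of _ "blk J a"])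
  ultimately show ?thesis by auto
qed

lemma finite_Blk: "J \<in> Ilam lam n \<Longrightarrow> k \<le> length lam \<Longrightarrow> finite (Blk J k)"
  by (simp add: Blk_eq)

lemma Blk_Suc:
  assumes J: "J \<in> Ilam lam n" and k: "k < length lam"
  shows "Blk J (Suc k) = Blk J k \<union> J ! k" "Blk J k \<inter> J ! k = {}"
  using k by (auto simp: Blk_eq[OF J] mem_block_iff[OF J])

lemma lev_Suc: "k < length lam \<Longrightarrow> lev lam (Suc k) = lev lam k + lam ! k"
  by (simp add: lev_def take_Suc_conv_app_nth)

lemma card_Blk:
  assumes J: "J \<in> Ilam lam n"
  shows "k \<le> length lam \<Longrightarrow> card (Blk J k) = lev lam k"
proof (induction k)
  case 0
  then show ?case by (simp add: Blk_def lev_def)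
next
  case (Suc k)
  then show ?case
    using Blk_Suc[OF J, of k] finite_Blk[OF J, of k] Ilam_finite[OF J, of k] Ilam_card[OF J, of k]
    by (simp add: card_Un_disjoint lev_Suc)
qed

lemma bij_betw_idx:
  assumes J: "J \<in> Ilam lam n" and k: "k \<le> length lam"
  shows "bij_betw (idx J k) {..<lev lam k} (Blk J k)"
  unfolding idx_def Blk_def[symmetric]
  by (rule bij_betw_nth) (use finite_Blk[OF assms] card_Blk[OF assms] in auto)

lemma idx_less_iff:
  assumes J: "J \<in> Ilam lam n" and k: "k \<le> length lam" and "a < lev lam k" "b < lev lam k"
  shows "idx J k a < idx J k b \<longleftrightarrow> a < b"
proof -
  have "idx J k a < idx J k b" if "a < b" "b < lev lam k" for a b
    unfolding idx_def Blk_def[symmetric]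
    by (rule sorted_wrt_nth_less[of "(<)"]) (use that card_Blk[OF J k] in auto)
  from this[of a b] this[of b a] show ?thesis
    using assms(3,4) by (cases a b rule: linorder_cases) auto
qed

lemma Blk_top: "J \<in> Ilam lam n \<Longrightarrow> Blk J (length lam) = {1..n}"
  using blk_props(1) by (auto simp: Blk_eq)

lemma lev_top: "lev lam (length lam) = sum_list lam"
  by (simp add: lev_def)

lemma idx_top:
  assumes J: "J \<in> Ilam lam n" and "a < n"
  shows "idx J (length lam) a = Suc a"
proof -
  have "{1..n} = {1..<Suc n}" by auto
  then have "sorted_list_of_set (Blk J (length lam)) = [1..<Suc n]"
    unfolding Blk_top[OF J] using sorted_list_of_set_range by metis
  then show ?thesis using assms(2) by (simp add: idx_def flip: Blk_def del: upt_Suc)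
qed

text \<open>The variables of level \<open>k\<close> are replaced by all \<open>gamma\<close> of the
  first \<open>k\<close> groups, in an arbitrary enumeration \<open>h k\<close>. As
  \<open>Wsum\<close> is symmetric in each level below the top, the result is symmetric in each
  group, and at \<open>x_J\<close> these variables become the \<open>z\<close> of the first
  \<open>k\<close> blocks of \<open>J\<close>.\<close>

lemma restr_lpoly:
  assumes n: "sum_list lam = n"
  obtains F where "symGZ lam n F"
    "\<And>J x. J \<in> Ilam lam n \<Longrightarrow> gen (Z ` {1..n}) x \<Longrightarrow>
      evalp x (restr J F) = Wval lam I J 0 (\<lambda>a. x (Z a))"
proof -
  let ?N = "length lam"
  obtain P where P: "\<And>x. nonzero x \<Longrightarrow> level_inj lam (\<lambda>k a. x (tv lam k a)) \<Longrightarrow>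
    evalp x P = Wsum lam I (\<lambda>k a. x (tv lam k a))"
    using Wsum_lpoly[of lam I] by blast
  define gam where "gam = (\<lambda>k. \<Union>j<k. G j ` {..<lam ! j})"
  have fin: "finite (gam k)" for k by (simp add: gam_def)
  have gam_iff: "v \<in> gam k \<longleftrightarrow> (\<exists>j i. v = G j i \<and> j < k \<and> i < lam ! j)" for v k
    by (auto simp: gam_def)
  have card_gam: "k \<le> ?N \<Longrightarrow> card (gam k) = lev lam k" for k
  proof (induction k)
    case 0
    then show ?case by (simp add: gam_def lev_def)
  next
    case (Suc k)
    have "gam (Suc k) = gam k \<union> G k ` {..<lam ! k}" by (simp add: gam_def lessThan_Suc Un_commute)
    moreover have "gam k \<inter> G k ` {..<lam ! k} = {}" by (auto simp: gam_def)
    moreover have "card (G k ` {..<lam ! k}) = lam ! k" by (subst card_image) (auto simp: inj_on_def)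
    ultimately show ?case using Suc fin[of k] by (simp add: card_Un_disjoint lev_Suc)
  qed
  have "\<exists>h. bij_betw h {..<lev lam k} (gam k)" if "k \<le> ?N" for k
    using ex_bij_betw_nat_finite[OF fin[of k]] card_gam[OF that] by (simp add: atLeast0LessThan)
  then obtain h where h: "\<And>k. k \<le> ?N \<Longrightarrow> bij_betw (h k) {..<lev lam k} (gam k)" by metis
  define \<tau> where "\<tau> = (\<lambda>v. case v of G k a \<Rightarrow> h k a | Z a \<Rightarrow> Z a)"
  define q where "q = (\<lambda>k a. if k < ?N then h k a else Z (Suc a))"
  define F where "F = rename \<tau> P"
  have qtv: "\<tau> (tv lam k a) = q k a" for k a by (simp add: \<tau>_def tv_def q_def)
  have q: "bij_betw (q k) {..<lev lam k} (gam k)" if "k \<in> {1..<?N}" for k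
    using h[of k] that by (simp add: q_def)
  have evF: "evalp x F = Wsum lam I (\<lambda>k a. x (q k a))"
    if x: "nonzero x" and inj: "\<And>k. k \<in> {1..<?N} \<Longrightarrow> inj_on x (gam k)" for x
  proof -
    have nz: "nonzero (\<lambda>v. x (\<tau> v))" using x by (simp add: nonzero_def)
    have "inj_on (\<lambda>a. x (q k a)) {..<lev lam k}" if k: "k \<in> {1..<?N}" for k
      using comp_inj_on[of "q k" "{..<lev lam k}" x] q[OF k] inj[OF k] by (simp add: bij_betw_def o_def)
    then have "level_inj lam (\<lambda>k a. x (\<tau> (tv lam k a)))"
      using x by (simp add: level_inj_def qtv nonzero_def)
    from P[OF nz this] show ?thesis using x by (simp add: F_def evalp_rename qtv)
  qed
  have gam_mono: "gam k \<subseteq> gam ?N" if "k \<in> {1..<?N}" for k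
    unfolding gam_def using that by (intro UN_mono) auto
  have vars: "vars F \<subseteq> {G k a | k a. k < length lam \<and> a < lam!k} \<union> {Z a | a. a \<in> {1..n}}"
  proof (rule lpoly_vars_subsetI[OF fin[of ?N]])
    show "gam ?N \<subseteq> {G k a | k a. k < length lam \<and> a < lam!k} \<union> {Z a | a. a \<in> {1..n}}"
      by (auto simp: gam_def)
    fix x y :: "var \<Rightarrow> complex"
    assume x: "gen (gam ?N) x" and y: "gen (gam ?N) y"
      and xy: "\<And>v. v \<in> {G k a | k a. k < length lam \<and> a < lam!k} \<union> {Z a | a. a \<in> {1..n}} \<Longrightarrow> x v = y v"
    have "evalp x F = Wsum lam I (\<lambda>k a. x (q k a))"
      using x gam_mono by (intro evF) (auto simp: gen_def intro: inj_on_subset)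
    also have "\<dots> = Wsum lam I (\<lambda>k a. y (q k a))"
    proof (rule Wsum_cong, rule xy)
      fix k a assume k: "1 \<le> k" "k \<le> ?N" "a < lev lam k"
      show "q k a \<in> {G k a | k a. k < length lam \<and> a < lam!k} \<union> {Z a | a. a \<in> {1..n}}"
      proof (cases "k < ?N")
        case True
        then have "q k a \<in> gam k" using bij_betwE[OF q[of k]] k by auto
        then show ?thesis using True by (auto simp: gam_iff)
      next
        case False
        then show ?thesis using k n by (auto simp: q_def lev_top)
      qed
    qed
    also have "\<dots> = evalp y F"
      using y gam_mono by (intro evF[symmetric]) (auto simp: gen_def intro: inj_on_subset)
    finally show "evalp x F = evalp y F" .
  qed
  have sym: "rename (\<lambda>v. case v of G l a \<Rightarrow> (if l = j then G l (\<sigma> a) else G l a) | Z a \<Rightarrow> Z a) F = F"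
    (is "rename ?\<rho> F = F")
    if j: "j < ?N" and \<sigma>: "\<sigma> permutes {..<lam!j}" for j \<sigma>
  proof (rule lpoly_eqI[OF fin[of ?N]])
    fix x assume x: "gen (gam ?N) x"
    \<comment> \<open>Permuting one group preserves the set of variables substituted at each level,
      whether or not the level contains that group; so \<open>Wsum_same_levels\<close>
      applies.\<close>
    have bij: "bij_betw ?\<rho> (gam k) (gam k)" for k
      by (rule bij_betw_byWitness[where f' = "\<lambda>v. case v of G l a \<Rightarrow> (if l = j then G l (inv \<sigma> a) else G l a) | Z a \<Rightarrow> Z a"])
        (use permutes_inverses[OF \<sigma>] permutes_in_image[OF \<sigma>] permutes_in_image[OF permutes_inv[OF \<sigma>]]
          in \<open>auto simp: gam_iff split: if_splits\<close>)
    have inj: "inj_on x (gam k)" if "k \<in> {1..<?N}" for k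
      using x gam_mono[OF that] by (auto simp: gen_def intro: inj_on_subset)
    have nz: "nonzero x" "nonzero (\<lambda>v. x (?\<rho> v))" using x by (auto simp: gen_def nonzero_def)
    have "evalp x (rename ?\<rho> F) = evalp (\<lambda>v. x (?\<rho> v)) F"
      using nz by (simp add: evalp_rename)
    also have "\<dots> = Wsum lam I (\<lambda>k a. x (?\<rho> (q k a)))"
    proof (rule evF[OF nz(2)])
      fix k assume "k \<in> {1..<?N}"
      then show "inj_on (\<lambda>v. x (?\<rho> v)) (gam k)"
        using comp_inj_on[of ?\<rho> "gam k" x] bij[of k] inj by (simp add: bij_betw_def o_def)
    qed
    also have "\<dots> = Wsum lam I (\<lambda>k a. x (q k a))"
    proof (rule Wsum_same_levels[where C = gam])
      fix k assume k: "k \<in> {1..<?N}"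
      show "bij_betw (q k) {..<lev lam k} (gam k)" using q[OF k] .
      from bij_betw_trans[OF this bij] show "bij_betw (\<lambda>a. ?\<rho> (q k a)) {..<lev lam k} (gam k)"
        by (simp add: o_def)
    qed (simp add: q_def)
    also have "\<dots> = evalp x F" by (rule evF[symmetric]) (use nz inj in auto)
    finally show "evalp x (rename ?\<rho> F) = evalp x F" .
  qed
  show ?thesis
  proof (rule that[of F])
    show "symGZ lam n F" using vars sym by (simp add: symGZ_def)
    fix J x assume J: "J \<in> Ilam lam n" and x: "gen (Z ` {1..n}) x"
    define rm where "rm = (\<lambda>v. case v of G k a \<Rightarrow> Z (sorted_list_of_set (J!k) ! a) | Z a \<Rightarrow> Z a)"
    \<comment> \<open>Surjectivity holds group by group; injectivity follows by counting.\<close>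
    have bij: "bij_betw rm (gam k) (Z ` Blk J k)" if k: "k \<le> ?N" for k
    proof -
      have "rm ` G j ` {..<lam!j} = Z ` (J!j)" if "j < k" for j
      proof -
        have "set (sorted_list_of_set (J!j)) = J!j" "length (sorted_list_of_set (J!j)) = lam!j"
          using Ilam_finite[OF J, of j] Ilam_card[OF J, of j] that k by auto
        then have "(\<lambda>i. sorted_list_of_set (J!j) ! i) ` {..<lam!j} = J!j"
          by (metis atLeast_upt list.set_map map_nth)
        then show ?thesis by (simp add: rm_def image_image) (metis image_image)
      qed
      then have "rm ` gam k = (\<Union>j<k. Z ` (J!j))"
        unfolding gam_def image_UN by simp
      also have "\<dots> = Z ` Blk J k"
        using k blk_props(2)[OF J] by (auto simp: Blk_eq[OF J] mem_block_iff[OF J] image_iff)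
      finally have im: "rm ` gam k = Z ` Blk J k" .
      have "card (rm ` gam k) = card (gam k)"
        unfolding im card_gam[OF k] by (subst card_image) (auto simp: inj_on_def card_Blk[OF J k])
      then have "inj_on rm (gam k)" by (rule eq_card_imp_inj_on[OF fin])
      with im show ?thesis by (simp add: bij_betw_def)
    qed
    have nz: "nonzero x" "nonzero (\<lambda>v. x (rm v))" using x by (auto simp: gen_def nonzero_def)
    have "evalp x (restr J F) = evalp (\<lambda>v. x (rm v)) F"
      unfolding restr_def rm_def[symmetric] using nz by (simp add: evalp_rename)
    also have "\<dots> = Wsum lam I (\<lambda>k a. x (rm (q k a)))"
    proof (rule evF[OF nz(2)])
      fix k assume k: "k \<in> {1..<?N}"
      have "inj_on x (Z ` Blk J k)"
        by (rule inj_on_subset[of _ "Z ` {1..n}"]) (use x k in \<open>auto simp: gen_def Blk_eq[OF J]\<close>)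
      then show "inj_on (\<lambda>v. x (rm v)) (gam k)"
        using comp_inj_on[of rm "gam k" x] bij[of k] k by (simp add: bij_betw_def o_def)
    qed
    also have "\<dots> = Wsum lam I (\<lambda>k a. x (Z (idx J k a)))"
    proof (rule Wsum_same_levels[where C = "\<lambda>k. Z ` Blk J k"])
      fix k assume k: "k \<in> {1..<?N}"
      show "bij_betw (\<lambda>a. rm (q k a)) {..<lev lam k} (Z ` Blk J k)"
        using bij_betw_trans[OF q[OF k] bij[of k]] k by (simp add: o_def)
      have "bij_betw Z (Blk J k) (Z ` Blk J k)" by (auto simp: bij_betw_def inj_on_def)
      from bij_betw_trans[OF bij_betw_idx[OF J] this] k
      show "bij_betw (\<lambda>a. Z (idx J k a)) {..<lev lam k} (Z ` Blk J k)" by (simp add: o_def)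
    qed (use n idx_top[OF J] in \<open>auto simp: q_def rm_def lev_top\<close>)
    finally show "evalp x (restr J F) = Wval lam I J 0 (\<lambda>a. x (Z a))"
      by (simp add: Wval_eq_Wsum)
  qed
qed

lemma vars_restr:
  assumes "symGZ lam n F" "J \<in> Ilam lam n"
  shows "vars (restr J F) \<subseteq> {Z a | a. a \<in> {1..n}}"
proof -
  let ?rm = "\<lambda>v. case v of G k a \<Rightarrow> Z (sorted_list_of_set (J!k) ! a) | Z a \<Rightarrow> Z a"
  have "sorted_list_of_set (J!k) ! a \<in> {1..n}" if "k < length lam" "a < lam!k" for k a
    using nth_mem[of a "sorted_list_of_set (J!k)"] Ilam_finite[OF assms(2), of k]
      Ilam_card[OF assms(2), of k] Ilam_subset[OF assms(2), of k] that by auto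
  moreover have "vars F \<subseteq> {G k a | k a. k < length lam \<and> a < lam!k} \<union> {Z a | a. a \<in> {1..n}}"
    using assms(1) by (simp add: symGZ_def)
  ultimately have "?rm ` vars F \<subseteq> {Z a | a. a \<in> {1..n}}"
    by (auto dest!: subsetD)
  then show ?thesis unfolding restr_def using vars_rename by blast
qed

text \<open>A Laurent polynomial is determined by its values at torus points with distinct
  \<open>z\<close>, so the description in \<open>Wres\<close> has at most one solution, and
  \<open>f\<close> is one.\<close>

lemma Wres_eq:
  assumes n: "sum_list lam = n" and J: "J \<in> Ilam lam n"
    and vars: "vars f \<subseteq> {Z a | a. a \<in> {1..n}}"
    and ev: "\<And>x. gen (Z ` {1..n}) x \<Longrightarrow> evalp x f = Wval lam I J 0 (\<lambda>a. x (Z a))"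
  shows "Wres lam n I J = f"
  unfolding Wres_def
proof (rule the_equality)
  have idx: "idx J k a \<in> {1..n}" if "k \<le> length lam" "a < lev lam k" for k a
    using bij_betwE[OF bij_betw_idx[OF J that(1)]] that Blk_eq[OF J that(1)] by auto
  have "evalp (\<lambda>v. case v of Z a \<Rightarrow> z a | G _ _ \<Rightarrow> 0) f = Wval lam I J 0 z" if z: "generic n z" for z
  proof -
    \<comment> \<open>The value \<open>1\<close> away from the given \<open>z\<close> makes
      \<open>x\<close> a torus point. \<open>Wres\<close> evaluates the variables \<open>G\<close>
      at \<open>0\<close>; the results agree because only \<open>Z a\<close> with
      \<open>a \<in> {1..n}\<close> occur in \<open>f\<close>.\<close>
    define x where "x = (\<lambda>v. case v of Z a \<Rightarrow> if a \<in> {1..n} then z a else 1 | G _ _ \<Rightarrow> 1)"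
    have x: "gen (Z ` {1..n}) x"
      using z by (auto simp: gen_def generic_def x_def nonzero_def inj_on_def split: var.splits)
    have "evalp (\<lambda>v. case v of Z a \<Rightarrow> z a | G _ _ \<Rightarrow> 0) f = evalp x f"
      by (rule evalp_cong) (use vars in \<open>auto simp: x_def\<close>)
    also have "\<dots> = Wval lam I J 0 (\<lambda>a. x (Z a))" by (rule ev[OF x])
    also have "\<dots> = Wval lam I J 0 z"
      unfolding Wval_eq_Wsum by (rule Wsum_cong) (use idx in \<open>auto simp: x_def\<close>)
    finally show ?thesis .
  qed
  with vars show "vars f \<subseteq> {Z a | a. a \<in> {1..n}}
      \<and> (\<forall>z. generic n z \<longrightarrow> evalp (\<lambda>v. case v of Z a \<Rightarrow> z a | G _ _ \<Rightarrow> 0) f = Wval lam I J 0 z)"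
    by blast
  fix g assume g: "vars g \<subseteq> {Z a | a. a \<in> {1..n}}
      \<and> (\<forall>z. generic n z \<longrightarrow> evalp (\<lambda>v. case v of Z a \<Rightarrow> z a | G _ _ \<Rightarrow> 0) g = Wval lam I J 0 z)"
  show "g = f"
  proof (rule lpoly_eqI[of "Z ` {1..n}"])
    fix x assume x: "gen (Z ` {1..n}) x"
    have "generic n (\<lambda>a. x (Z a))"
      unfolding generic_def
    proof (intro conjI ballI impI)
      show "x (Z a) \<noteq> 0" for a using x by (simp add: gen_def nonzero_def)
      fix a b assume "a \<in> {1..n}" "b \<in> {1..n}" "a \<noteq> b"
      then show "x (Z a) \<noteq> x (Z b)" using x inj_onD[of x "Z ` {1..n}" "Z a" "Z b"] by (auto simp: gen_def)
    qed
    with g have "evalp (\<lambda>v. case v of Z a \<Rightarrow> x (Z a) | G _ _ \<Rightarrow> 0) g = Wval lam I J 0 (\<lambda>a. x (Z a))"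
      by blast
    then have "evalp (\<lambda>v. case v of Z a \<Rightarrow> x (Z a) | G _ _ \<Rightarrow> 0) g = evalp x f"
      unfolding ev[OF x] .
    moreover have "evalp (\<lambda>v. case v of Z a \<Rightarrow> x (Z a) | G _ _ \<Rightarrow> 0) g = evalp x g"
      by (rule evalp_cong) (use g in auto)
    ultimately show "evalp x g = evalp x f" by simp
  qed simp
qed

section \<open>Degree estimates\<close>

definition Tpol :: "nat list \<Rightarrow> nat set list \<Rightarrow> (nat \<Rightarrow> nat \<Rightarrow> nat) \<Rightarrow> lpoly" where
  "Tpol lam J p = (\<Prod>k\<in>{1..<length lam}. \<Prod>a\<in>Blk J k.
     (\<Prod>b\<in>{b\<in>Blk J (Suc k). p k a < p (Suc k) b}. lin (Z a) (Z b))
   * (\<Prod>b\<in>{b\<in>Blk J k. p k b < p k a}. lin (Z a) (Z b)))"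

definition Opol :: "nat list \<Rightarrow> nat set list \<Rightarrow> lpoly" where
  "Opol lam J = (\<Prod>k\<in>{1..<length lam}. \<Prod>a\<in>Blk J k. \<Prod>b\<in>Blk J k - {a}. lin (Z a) (Z b))"

text \<open>A summand of \<open>W\<^sub>I(z\<^sub>J, z, 0)\<close> is encoded by the bijections \<open>pp \<dots> k\<close> from the union of the first
  \<open>k\<close> blocks of \<open>J\<close> onto that of \<open>I\<close>: if \<open>z\<^sub>j\<close> is substituted for the \<open>a\<close>-th variable of level \<open>k\<close>,
  then \<open>j\<close> is mapped to \<open>idx I k a\<close>. The polynomial \<open>Tpol\<close> is this summand times \<open>Opol\<close>.\<close>

definition qq :: "nat set list \<Rightarrow> (nat \<Rightarrow> nat \<Rightarrow> nat) \<Rightarrow> nat \<Rightarrow> nat \<Rightarrow> nat" where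
  "qq J \<sigma> k a = idx J k (\<sigma> k a)"

definition pp :: "nat list \<Rightarrow> nat set list \<Rightarrow> nat set list \<Rightarrow> (nat \<Rightarrow> nat \<Rightarrow> nat) \<Rightarrow> nat \<Rightarrow> nat \<Rightarrow> nat" where
  "pp lam I J \<sigma> k j = idx I k (inv_into {..<lev lam k} (qq J \<sigma> k) j)"

lemma bij_betw_qq:
  assumes J: "J \<in> Ilam lam n" and \<sigma>: "\<sigma> \<in> symperms lam" and k: "k \<le> length lam"
  shows "bij_betw (qq J \<sigma> k) {..<lev lam k} (Blk J k)"
  using bij_betw_trans[OF permutes_imp_bij[OF symperms_permutes[OF \<sigma>]] bij_betw_idx[OF J k]]
  by (simp add: qq_def[abs_def] o_def)

lemma pp_qq:
  assumes J: "J \<in> Ilam lam n" and \<sigma>: "\<sigma> \<in> symperms lam" and k: "k \<le> length lam" and a: "a < lev lam k"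
  shows "pp lam I J \<sigma> k (qq J \<sigma> k a) = idx I k a"
  unfolding pp_def
  using inv_into_f_f[OF bij_betw_imp_inj_on[OF bij_betw_qq[OF J \<sigma> k]]] a by simp

lemma bij_betw_pp:
  assumes "I \<in> Ilam lam n" "J \<in> Ilam lam n" "\<sigma> \<in> symperms lam" "k \<le> length lam"
  shows "bij_betw (pp lam I J \<sigma> k) (Blk J k) (Blk I k)"
  using bij_betw_trans[OF bij_betw_inv_into[OF bij_betw_qq[OF assms(2-4)]] bij_betw_idx[OF assms(1,4)]]
  by (simp add: pp_def[abs_def] o_def)

lemma pp_top:
  assumes "sum_list lam = n" "I \<in> Ilam lam n" "J \<in> Ilam lam n" "\<sigma> \<in> symperms lam" "j \<in> {1..n}"
  shows "pp lam I J \<sigma> (length lam) j = j"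
proof -
  let ?N = "length lam"
  have "j \<in> qq J \<sigma> ?N ` {..<lev lam ?N}"
    using bij_betw_imp_surj_on[OF bij_betw_qq[OF assms(3,4), of ?N]] assms(5) Blk_top[OF assms(3)] by simp
  then obtain a where a: "a < lev lam ?N" "j = qq J \<sigma> ?N a" by auto
  have "\<sigma> ?N = id" using assms(4) by (simp add: symperms_def)
  then have "j = Suc a" using a idx_top[OF assms(3)] assms(1) by (simp add: qq_def lev_top)
  then show ?thesis
    using pp_qq[OF assms(3,4), of ?N a I] a idx_top[OF assms(2)] assms(1) by (simp add: lev_top)
qed

lemma evalp_Tpol:
  assumes I: "I \<in> Ilam lam n" and J: "J \<in> Ilam lam n" and \<sigma>: "\<sigma> \<in> symperms lam" and x: "nonzero x"
  shows "evalp x (Tpol lam J (pp lam I J \<sigma>)) = Avals lam I (\<lambda>k a. x (Z (qq J \<sigma> k a)))"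
proof -
  let ?p = "pp lam I J \<sigma>" and ?q = "qq J \<sigma>"
  have eq: "(\<Prod>a\<in>Blk J k. (\<Prod>b\<in>{b\<in>Blk J (Suc k). ?p k a < ?p (Suc k) b}. 1 - x (Z b) / x (Z a))
        * (\<Prod>b\<in>{b\<in>Blk J k. ?p k b < ?p k a}. 1 - x (Z b) / x (Z a)))
    = (\<Prod>a<lev lam k. (\<Prod>c\<in>{c. c < lev lam (Suc k) \<and> idx I (Suc k) c > idx I k a}. 1 - x (Z (?q (Suc k) c)) / x (Z (?q k a)))
        * (\<Prod>b<a. 1 - x (Z (?q k b)) / x (Z (?q k a))))"
    if k: "k \<in> {1..<length lam}" for k
  proof -
    have kN: "k \<le> length lam" "Suc k \<le> length lam" using k by auto
    note q = bij_betw_qq[OF J \<sigma>]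
    have "(\<Prod>b\<in>{b\<in>Blk J (Suc k). idx I k a < ?p (Suc k) b}. 1 - x (Z b) / x (Z (?q k a)))
        = (\<Prod>c\<in>{c. c < lev lam (Suc k) \<and> idx I (Suc k) c > idx I k a}. 1 - x (Z (?q (Suc k) c)) / x (Z (?q k a)))"
      for a
    proof (rule prod.reindex_bij_betw[symmetric, where h = "?q (Suc k)"])
      show "bij_betw (?q (Suc k)) {c. c < lev lam (Suc k) \<and> idx I (Suc k) c > idx I k a}
          {b\<in>Blk J (Suc k). idx I k a < ?p (Suc k) b}"
        using bij_betw_Collect[OF q[OF kN(2)], of "\<lambda>b. idx I k a < ?p (Suc k) b"
            "\<lambda>c. idx I k a < idx I (Suc k) c"] pp_qq[OF J \<sigma> kN(2), of _ I]
        by simp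
    qed
    moreover have "(\<Prod>b\<in>{b\<in>Blk J k. ?p k b < idx I k a}. 1 - x (Z b) / x (Z (?q k a)))
        = (\<Prod>b<a. 1 - x (Z (?q k b)) / x (Z (?q k a)))" if a: "a < lev lam k" for a
    proof (rule prod.reindex_bij_betw[symmetric, where h = "?q k"])
      have "{..<a} = {c. c < lev lam k \<and> idx I k c < idx I k a}"
        using idx_less_iff[OF I kN(1)] a by auto
      then show "bij_betw (?q k) {..<a} {b\<in>Blk J k. ?p k b < idx I k a}"
        using bij_betw_Collect[OF q[OF kN(1)], of "\<lambda>b. ?p k b < idx I k a"
            "\<lambda>c. idx I k c < idx I k a"] pp_qq[OF J \<sigma> kN(1), of _ I]
        by simp
    qed
    ultimately show ?thesis
      by (subst prod.reindex_bij_betw[OF q[OF kN(1)], symmetric])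
        (auto intro!: prod.cong simp: pp_qq[OF J \<sigma> kN(1)])
  qed
  have "Avals lam I (\<lambda>k a. x (Z (?q k a))) = (\<Prod>k\<in>{1..<length lam}. \<Prod>a\<in>Blk J k.
      (\<Prod>b\<in>{b\<in>Blk J (Suc k). ?p k a < ?p (Suc k) b}. 1 - x (Z b) / x (Z a))
        * (\<Prod>b\<in>{b\<in>Blk J k. ?p k b < ?p k a}. 1 - x (Z b) / x (Z a)))"
    unfolding Avals_def by (rule prod.cong[OF refl eq[symmetric]])
  then show ?thesis
    using x by (simp add: Tpol_def evalp_prod evalp_mult evalp_lin)
qed

lemma evalp_Opol:
  assumes J: "J \<in> Ilam lam n" and x: "nonzero x"
  shows "evalp x (Opol lam J) = Ovals lam (\<lambda>k a. x (Z (idx J k a)))"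
proof -
  have "(\<Prod>a\<in>Blk J k. \<Prod>b\<in>Blk J k - {a}. 1 - x (Z b) / x (Z a))
    = (\<Prod>a<lev lam k. \<Prod>b\<in>{..<lev lam k} - {a}. 1 - x (Z (idx J k b)) / x (Z (idx J k a)))"
    if k: "k \<in> {1..<length lam}" for k
    using prod_offdiag_reindex[OF bij_betw_idx[OF J, of k], of "\<lambda>a b. 1 - x (Z b) / x (Z a)"] k by simp
  then have "Ovals lam (\<lambda>k a. x (Z (idx J k a)))
      = (\<Prod>k\<in>{1..<length lam}. \<Prod>a\<in>Blk J k. \<Prod>b\<in>Blk J k - {a}. 1 - x (Z b) / x (Z a))"
    unfolding Ovals_def by (rule prod.cong[OF refl, symmetric])
  then show ?thesis
    using x by (simp add: Opol_def evalp_prod evalp_lin)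
qed

text \<open>Reduces degree bounds for \<open>f\<close> to the single summands, each a product of
  factors \<open>lin\<close>.\<close>

lemma Wval_lpoly_mult_Opol:
  assumes I: "I \<in> Ilam lam n" and J: "J \<in> Ilam lam n"
    and ev: "\<And>x. gen (Z ` {1..n}) x \<Longrightarrow> evalp x f = Wval lam I J 0 (\<lambda>a. x (Z a))"
  shows "f * Opol lam J = (\<Sum>\<sigma>\<in>symperms lam. Tpol lam J (pp lam I J \<sigma>))"
proof (rule lpoly_eqI[of "Z ` {1..n}"])
  fix x assume x: "gen (Z ` {1..n}) x"
  then have nz: "nonzero x" by (simp add: gen_def)
  let ?t = "\<lambda>k a. x (Z (idx J k a))"
  have "level_inj lam ?t"
    unfolding level_inj_def
  proof (intro ballI conjI allI impI)
    fix k assume k: "k \<in> {1..<length lam}"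
    have "inj_on x (Z ` Blk J k)"
      by (rule inj_on_subset[of _ "Z ` {1..n}"]) (use x k in \<open>auto simp: gen_def Blk_eq[OF J]\<close>)
    then have "inj_on (\<lambda>a. x (Z a)) (Blk J k)" by (auto simp: inj_on_def)
    then show "inj_on (?t k) {..<lev lam k}"
      using comp_inj_on[of "idx J k" "{..<lev lam k}" "\<lambda>a. x (Z a)"] bij_betw_idx[OF J, of k] k
      by (simp add: bij_betw_def o_def)
  qed (use nz in \<open>simp add: nonzero_def\<close>)
  from Wsum_Ovals[OF this, of I] show "evalp x (f * Opol lam J) = evalp x (\<Sum>\<sigma>\<in>symperms lam. Tpol lam J (pp lam I J \<sigma>))"
    using nz by (simp add: evalp_mult evalp_Opol[OF J] ev[OF x] Wval_eq_Wsum evalp_sum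
        evalp_Tpol[OF I J] qq_def cong: sum.cong)
qed simp

text \<open>Otherwise the first product of \<open>Tpol\<close> contains the case
  \<open>b = a\<close>, whose factor is \<open>0\<close>.\<close>

lemma Tpol_nonzero_mono:
  assumes J: "J \<in> Ilam lam n" and "Tpol lam J p \<noteq> 0" and k: "k \<in> {1..<length lam}" and a: "a \<in> Blk J k"
  shows "p (Suc k) a \<le> p k a"
proof (rule ccontr)
  assume "\<not> p (Suc k) a \<le> p k a"
  have fin: "finite (Blk J k)" "finite (Blk J (Suc k))"
    using finite_Blk[OF J] k by auto
  have "a \<in> Blk J (Suc k)" using a k Blk_Suc[OF J, of k] by auto
  then have "(\<Prod>b\<in>{b\<in>Blk J (Suc k). p k a < p (Suc k) b}. lin (Z a) (Z b)) = 0"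
    using \<open>\<not> p (Suc k) a \<le> p k a\<close> fin by (intro prod_zero bexI[of _ a]) auto
  then have "Tpol lam J p = 0"
    unfolding Tpol_def using k a fin by (intro prod_zero bexI[of _ k] bexI[of _ a]) auto
  with assms(2) show False by simp
qed

section \<open>Comparison of degrees level by level\<close>

definition rise :: "(var \<Rightarrow> int) \<Rightarrow> nat \<Rightarrow> nat \<Rightarrow> int" where
  "rise w a b = max 0 (w (Z b) - w (Z a))"

lemma rise_nonneg: "0 \<le> rise w a b"
  by (simp add: rise_def)

text \<open>\<open>Num k\<close> and \<open>Dn k\<close> are the degrees of the numerator and of the denominator of level \<open>k\<close>.\<close>

definition Num :: "(var \<Rightarrow> int) \<Rightarrow> nat set list \<Rightarrow> (nat \<Rightarrow> nat \<Rightarrow> nat) \<Rightarrow> nat \<Rightarrow> int" where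
  "Num w J p k = (\<Sum>a\<in>Blk J k. \<Sum>b\<in>{b\<in>Blk J (Suc k). p k a < p (Suc k) b}. rise w a b)"

definition Dn :: "(var \<Rightarrow> int) \<Rightarrow> nat set list \<Rightarrow> (nat \<Rightarrow> nat \<Rightarrow> nat) \<Rightarrow> nat \<Rightarrow> int" where
  "Dn w J p k = (\<Sum>a\<in>Blk J k. \<Sum>b\<in>{b\<in>Blk J k. p k a < p k b}. rise w a b)"

definition Odeg :: "(var \<Rightarrow> int) \<Rightarrow> nat list \<Rightarrow> nat set list \<Rightarrow> int" where
  "Odeg w lam J = (\<Sum>k\<in>{1..<length lam}. \<Sum>a\<in>Blk J k. \<Sum>b\<in>Blk J k - {a}. rise w a b)"

text \<open>An exact degree, since every factor has \<open>a \<noteq> b\<close>;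
  \<open>rise w a b\<close> is the degree of \<open>lin (Z a) (Z b)\<close>.\<close>

lemma topdeg_Opol: "topdeg w (Odeg w lam J) (Opol lam J)"
  unfolding Odeg_def Opol_def rise_def by (intro topdeg_prod topdeg_lin) auto

text \<open>The pairs with \<open>p k b < p k a\<close> contribute equally to \<open>Tpol\<close>
  and \<open>Opol\<close>, which leaves the comparison of \<open>Num\<close> with \<open>Dn\<close>.
  Injectivity of \<open>p k\<close> splits the off-diagonal pairs of \<open>Opol\<close> into the
  two orders.\<close>

lemma degle_Tpol:
  assumes J: "J \<in> Ilam lam n" and inj: "\<And>k. k \<in> {1..<length lam} \<Longrightarrow> inj_on (p k) (Blk J k)"
    and bound: "(\<Sum>k\<in>{1..<length lam}. Num w J p k) \<le> (\<Sum>k\<in>{1..<length lam}. Dn w J p k) + B"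
  shows "degle w (B + Odeg w lam J) (Tpol lam J p)"
proof -
  let ?K = "{1..<length lam}"
  let ?L = "\<lambda>k. \<Sum>a\<in>Blk J k. \<Sum>b\<in>{b\<in>Blk J k. p k b < p k a}. rise w a b"
  have "degle w (\<Sum>k\<in>?K. \<Sum>a\<in>Blk J k. (\<Sum>b\<in>{b\<in>Blk J (Suc k). p k a < p (Suc k) b}. rise w a b)
      + (\<Sum>b\<in>{b\<in>Blk J k. p k b < p k a}. rise w a b)) (Tpol lam J p)"
    unfolding Tpol_def rise_def by (intro degle_prod degle_mult degle_lin)
  also have "(\<Sum>k\<in>?K. \<Sum>a\<in>Blk J k. (\<Sum>b\<in>{b\<in>Blk J (Suc k). p k a < p (Suc k) b}. rise w a b)
      + (\<Sum>b\<in>{b\<in>Blk J k. p k b < p k a}. rise w a b)) = (\<Sum>k\<in>?K. Num w J p k) + (\<Sum>k\<in>?K. ?L k)"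
    by (simp add: Num_def sum.distrib)
  finally have "degle w ((\<Sum>k\<in>?K. Num w J p k) + (\<Sum>k\<in>?K. ?L k)) (Tpol lam J p)" .
  moreover have "Odeg w lam J = (\<Sum>k\<in>?K. Dn w J p k) + (\<Sum>k\<in>?K. ?L k)"
    unfolding Odeg_def Dn_def sum.distrib[symmetric]
  proof (intro sum.cong refl)
    fix k a assume k: "k \<in> ?K" and a: "a \<in> Blk J k"
    have fin: "finite (Blk J k)" using finite_Blk[OF J] k by auto
    have "p k b < p k a \<or> p k a < p k b" if "b \<in> Blk J k - {a}" for b
      using inj_onD[OF inj[OF k], of b a] a that by (metis DiffE insertI1 linorder_neqE_nat)
    then have split: "Blk J k - {a} = {b\<in>Blk J k. p k a < p k b} \<union> {b\<in>Blk J k. p k b < p k a}"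
      by auto
    show "(\<Sum>b\<in>Blk J k - {a}. rise w a b) = (\<Sum>b\<in>{b\<in>Blk J k. p k a < p k b}. rise w a b)
        + (\<Sum>b\<in>{b\<in>Blk J k. p k b < p k a}. rise w a b)"
      unfolding split by (rule sum.union_disjoint) (use fin in auto)
  qed
  ultimately show ?thesis using bound by (auto elim: degle_mono)
qed

text \<open>Vanishing summands satisfy any bound. The bound on \<open>f * Opol lam J\<close> passes
  to \<open>f\<close> because top degrees are additive.\<close>

lemma Wval_lpoly_degle:
  assumes I: "I \<in> Ilam lam n" and J: "J \<in> Ilam lam n"
    and f: "f * Opol lam J = (\<Sum>\<sigma>\<in>symperms lam. Tpol lam J (pp lam I J \<sigma>))"
    and bound: "\<And>\<sigma>. \<sigma> \<in> symperms lam \<Longrightarrow> Tpol lam J (pp lam I J \<sigma>) \<noteq> 0 \<Longrightarrow>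
      (\<Sum>k\<in>{1..<length lam}. Num w J (pp lam I J \<sigma>) k)
        \<le> (\<Sum>k\<in>{1..<length lam}. Dn w J (pp lam I J \<sigma>) k) + B"
  shows "degle w B f"
proof (cases "f = 0")
  case False
  obtain d where d: "topdeg w d f" using topdeg_exists[OF False] .
  have "degle w (B + Odeg w lam J) (f * Opol lam J)"
    unfolding f
  proof (rule degle_sum)
    fix \<sigma> assume \<sigma>: "\<sigma> \<in> symperms lam"
    show "degle w (B + Odeg w lam J) (Tpol lam J (pp lam I J \<sigma>))"
    proof (cases "Tpol lam J (pp lam I J \<sigma>) = 0")
      case False
      show ?thesis
        by (rule degle_Tpol[OF J _ bound[OF \<sigma> False]])
          (use bij_betw_imp_inj_on[OF bij_betw_pp[OF I J \<sigma>]] in auto)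
    qed simp
  qed
  then have "d + Odeg w lam J \<le> B + Odeg w lam J"
    using topdeg_degle[OF topdeg_mult[OF d topdeg_Opol]] by blast
  with d show ?thesis by (auto simp: topdeg_def elim: degle_mono)
qed simp

text \<open>A bijection of \<open>A\<close> preserves the sum of the elements, so no element can
  move up.\<close>

lemma increasing_bij_id:
  fixes p :: "nat \<Rightarrow> nat"
  assumes "finite A" "bij_betw p A A" "\<And>a. a \<in> A \<Longrightarrow> a \<le> p a" "a \<in> A"
  shows "p a = a"
proof (rule ccontr)
  assume "p a \<noteq> a"
  then have "a < p a" using assms(3,4) by (simp add: order.strict_iff_order)
  then have "(\<Sum>a\<in>A. a) < (\<Sum>a\<in>A. p a)"
    using assms by (intro sum_strict_mono_ex1) auto
  moreover have "(\<Sum>a\<in>A. p a) = (\<Sum>a\<in>A. a)" by (rule sum.reindex_bij_betw[OF assms(2)])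
  ultimately show False by simp
qed

text \<open>For the negated weight only pairs with \<open>b\<close> in an earlier block than
  \<open>a\<close> contribute. Such a \<open>b\<close> already lies in \<open>Blk J k\<close>, where
  \<open>p (Suc k) b \<le> p k b\<close>; so the same level can be compared, without
  telescoping.\<close>

lemma Num_le_Dn_lower:
  assumes J: "J \<in> Ilam lam n" and k: "k \<in> {1..<length lam}"
    and mono: "\<And>a. a \<in> Blk J k \<Longrightarrow> p (Suc k) a \<le> p k a"
  shows "Num (\<lambda>v. - phiw J v) J p k \<le> Dn (\<lambda>v. - phiw J v) J p k"
  unfolding Num_def Dn_def
proof (rule sum_mono)
  fix a assume a: "a \<in> Blk J k"
  let ?w = "\<lambda>v. - phiw J v"
  have kN: "k \<le> length lam" "Suc k \<le> length lam" using k by auto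
  have fin: "finite (Blk J k)" "finite (Blk J (Suc k))" using finite_Blk[OF J] kN by auto
  have "(\<Sum>b\<in>{b\<in>Blk J (Suc k). p k a < p (Suc k) b}. rise ?w a b)
      = (\<Sum>b\<in>{b\<in>Blk J k. p k a < p (Suc k) b}. rise ?w a b)"
  proof (rule sum.mono_neutral_right)
    show "\<forall>b\<in>{b\<in>Blk J (Suc k). p k a < p (Suc k) b} - {b\<in>Blk J k. p k a < p (Suc k) b}. rise ?w a b = 0"
      using a by (auto simp: Blk_eq[OF J kN(1)] Blk_eq[OF J kN(2)] rise_def phiw_Z[OF J])
  qed (use fin kN in \<open>auto simp: Blk_eq[OF J]\<close>)
  also have "\<dots> \<le> (\<Sum>b\<in>{b\<in>Blk J k. p k a < p k b}. rise ?w a b)"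
    by (rule sum_mono2) (use fin mono in \<open>auto simp: rise_nonneg intro: less_le_trans\<close>)
  finally show "(\<Sum>b\<in>{b\<in>Blk J (Suc k). p k a < p (Suc k) b}. rise ?w a b)
    \<le> (\<Sum>b\<in>{b\<in>Blk J k. p k a < p k b}. rise ?w a b)" .
qed

text \<open>Because \<open>p (Suc k) a \<le> p k a\<close>, each pair counted by \<open>Num\<close>
  at \<open>k\<close> is counted by \<open>Dn\<close> at \<open>Suc k\<close>. The second part
  exhibits a pair of positive degree that only \<open>Dn\<close> counts.\<close>

lemma Num_le_Dn_Suc:
  assumes J: "J \<in> Ilam lam n" and k: "k \<in> {1..<length lam}"
    and mono: "\<And>a. a \<in> Blk J k \<Longrightarrow> p (Suc k) a \<le> p k a"
  shows "Num w J p k \<le> Dn w J p (Suc k)"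
    and "\<lbrakk>a \<in> Blk J k; b \<in> Blk J (Suc k); p (Suc k) a < p (Suc k) b; p (Suc k) b \<le> p k a; rise w a b > 0\<rbrakk>
      \<Longrightarrow> Num w J p k < Dn w J p (Suc k)"
proof -
  let ?N = "\<lambda>a. {b\<in>Blk J (Suc k). p k a < p (Suc k) b}"
    and ?D = "\<lambda>a. {b\<in>Blk J (Suc k). p (Suc k) a < p (Suc k) b}"
  have fin: "finite (Blk J k)" "finite (Blk J (Suc k))" using finite_Blk[OF J] k by auto
  have sub: "Blk J k \<subseteq> Blk J (Suc k)" using Blk_Suc[OF J] k by auto
  have ND: "?N a \<subseteq> ?D a" if "a \<in> Blk J k" for a using mono[OF that] by auto
  have 1: "(\<Sum>b\<in>?N a. rise w a b) \<le> (\<Sum>b\<in>?D a. rise w a b)" if "a \<in> Blk J k" for a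
    by (rule sum_mono2) (use fin ND[OF that] in \<open>auto simp: rise_nonneg\<close>)
  have 2: "(\<Sum>a\<in>Blk J k. \<Sum>b\<in>?D a. rise w a b) \<le> Dn w J p (Suc k)"
    unfolding Dn_def by (rule sum_mono2[OF fin(2) sub]) (auto intro: sum_nonneg rise_nonneg)
  have "Num w J p k \<le> (\<Sum>a\<in>Blk J k. \<Sum>b\<in>?D a. rise w a b)"
    unfolding Num_def by (rule sum_mono) (rule 1)
  with 2 show "Num w J p k \<le> Dn w J p (Suc k)" by simp
  assume ab: "a \<in> Blk J k" "b \<in> Blk J (Suc k)" "p (Suc k) a < p (Suc k) b" "p (Suc k) b \<le> p k a" "rise w a b > 0"
  have "(\<Sum>b\<in>?N a. rise w a b) < (\<Sum>b\<in>?D a. rise w a b)"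
  proof (rule sum_strict_mono2[of _ _ b])
    show "b \<in> ?D a - ?N a" using ab by auto
  qed (use fin ND[OF ab(1)] ab in \<open>auto simp: rise_nonneg\<close>)
  then have "Num w J p k < (\<Sum>a\<in>Blk J k. \<Sum>b\<in>?D a. rise w a b)"
    unfolding Num_def using fin 1 ab(1) by (intro sum_strict_mono_ex1) auto
  with 2 show "Num w J p k < Dn w J p (Suc k)" by simp
qed

text \<open>The end value of the telescoping sum. Pairs \<open>a < b\<close> outside
  \<open>noninv n J\<close> have \<open>rise\<close> equal to \<open>0\<close>.\<close>

lemma Dn_top:
  assumes J: "J \<in> Ilam lam n" and id: "\<And>a. a \<in> {1..n} \<Longrightarrow> p (length lam) a = a"
  shows "Dn (phiw J) J p (length lam) = mdeg n J"
proof -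
  have "Dn (phiw J) J p (length lam) = (\<Sum>a\<in>{1..n}. \<Sum>b\<in>{b\<in>{1..n}. a < b}. rise (phiw J) a b)"
    unfolding Dn_def Blk_top[OF J] using id by (intro sum.cong) auto
  also have "\<dots> = (\<Sum>(a, b)\<in>(SIGMA a:{1..n}. {b\<in>{1..n}. a < b}). rise (phiw J) a b)"
    by (rule sum.Sigma) auto
  also have "\<dots> = (\<Sum>(a, b)\<in>noninv n J. rise (phiw J) a b)"
    by (rule sum.mono_neutral_right) (auto simp: noninv_def rise_def phiw_Z[OF J])
  also have "\<dots> = mdeg n J"
    unfolding mdeg_def by (rule sum.cong) (auto simp: noninv_def rise_def phiw_Z[OF J])
  finally show ?thesis .
qed

lemma Num_le_Dn_upper:
  assumes J: "J \<in> Ilam lam n" and I: "I \<in> Ilam lam n" and "J \<noteq> I"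
    and mono: "\<And>k a. k \<in> {1..<length lam} \<Longrightarrow> a \<in> Blk J k \<Longrightarrow> p (Suc k) a \<le> p k a"
    and bij: "\<And>k. k \<le> length lam \<Longrightarrow> bij_betw (p k) (Blk J k) (Blk I k)"
    and top: "\<And>a. a \<in> {1..n} \<Longrightarrow> p (length lam) a = a"
  shows "(\<Sum>k\<in>{1..<length lam}. Num (phiw J) J p k)
    \<le> (\<Sum>k\<in>{1..<length lam}. Dn (phiw J) J p k) + (mdeg n J - 1)"
proof -
  let ?N = "length lam" and ?w = "phiw J"
  define M where "M = {k \<in> {1..<?N}. \<exists>a\<in>Blk J k. p k a \<noteq> a}"
  have Bid: "Blk I k = Blk J k" if "k \<le> ?N" "\<And>a. a \<in> Blk J k \<Longrightarrow> p k a = a" for k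
    using bij_betw_imp_surj_on[OF bij[OF that(1)]] that(2) by auto
  \<comment> \<open>If all levels were the identity, surjectivity of each \<open>p k\<close> would
    identify the unions of initial blocks, hence \<open>I\<close> and \<open>J\<close>.\<close>
  have "M \<noteq> {}"
  proof
    assume "M = {}"
    have B: "Blk I k = Blk J k" if k: "k \<le> ?N" for k
    proof (cases "k \<in> {1..<?N}")
      case True
      then show ?thesis using \<open>M = {}\<close> by (intro Bid) (auto simp: M_def)
    next
      case False
      then have "k = 0 \<or> k = ?N" using k by auto
      then show ?thesis by (auto simp: Blk_top[OF I] Blk_top[OF J]) (auto simp: Blk_def)
    qed
    have "I = J"
    proof (rule Ilam_eqI[OF I J])
      fix a assume a: "a \<in> {1..n}"
      have "blk I a < k \<longleftrightarrow> blk J a < k" if "k \<le> ?N" for k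
        using B[OF that] a by (auto simp: Blk_eq[OF I that] Blk_eq[OF J that])
      from this[of "Suc (blk I a)"] this[of "Suc (blk J a)"]
      show "blk I a = blk J a"
        using blk_props(1)[OF I a] blk_props(1)[OF J a] by (simp add: Suc_le_eq)
    qed
    with \<open>J \<noteq> I\<close> show False by simp
  qed
  have finM: "finite M" by (simp add: M_def)
  \<comment> \<open>By maximality the next level is the identity, for the top level by
    hypothesis.\<close>
  define k where "k = Max M"
  have kM: "k \<in> M" using \<open>M \<noteq> {}\<close> finM by (simp add: k_def)
  then have k: "k \<in> {1..<?N}" and kN: "k \<le> ?N" "Suc k \<le> ?N" by (auto simp: M_def)
  have id: "p (Suc k) a = a" if "a \<in> Blk J (Suc k)" for a
  proof (cases "Suc k = ?N")
    case True
    then show ?thesis using top that by (simp add: Blk_top[OF J])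
  next
    case False
    have "Suc k \<notin> M" using Max_ge[OF finM, of "Suc k", folded k_def] by auto
    then show ?thesis using False k that by (auto simp: M_def)
  qed
  have sub: "Blk J k \<subseteq> Blk J (Suc k)" "Blk I k \<subseteq> Blk I (Suc k)"
    using Blk_Suc[OF J] Blk_Suc[OF I] k by auto
  have ge: "a \<le> p k a" if "a \<in> Blk J k" for a
    using mono[OF k that] id[of a] sub that by auto
  have pin: "p k a \<in> Blk J (Suc k)" if "a \<in> Blk J k" for a
    using bij_betwE[OF bij[OF kN(1)]] that sub(2) Bid[OF kN(2) id] by blast
  \<comment> \<open>Moving elements only upwards, \<open>p k\<close> cannot be a nontrivial
    permutation of \<open>Blk J k\<close>, so it moves some element out of this set.\<close>
  have "\<exists>a\<in>Blk J k. p k a \<notin> Blk J k"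
  proof (rule ccontr)
    assume "\<not> ?thesis"
    then have "p k ` Blk J k \<subseteq> Blk J k" by auto
    moreover have inj: "inj_on (p k) (Blk J k)" using bij[OF kN(1)] by (simp add: bij_betw_def)
    ultimately have "bij_betw (p k) (Blk J k) (Blk J k)"
      using endo_inj_surj[OF finite_Blk[OF J kN(1)]] by (simp add: bij_betw_def)
    then have "p k a = a" if "a \<in> Blk J k" for a
      using increasing_bij_id[OF finite_Blk[OF J kN(1)]] ge that by blast
    with kM show False by (auto simp: M_def)
  qed
  then obtain a where a: "a \<in> Blk J k" "p k a \<notin> Blk J k" by blast
  \<comment> \<open>The boundary case \<open>p (Suc k) b = b = p k a\<close>: the pair is counted by
    \<open>Dn\<close> at \<open>Suc k\<close> but not by \<open>Num\<close> at \<open>k\<close>, and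
    it has positive degree because \<open>b\<close> lies in a later block than
    \<open>a\<close>.\<close>
  define b where "b = p k a"
  have b: "b \<in> Blk J (Suc k)" "b \<notin> Blk J k" using pin a by (auto simp: b_def)
  then have "blk J a < blk J b" "a \<in> {1..n}" "b \<in> {1..n}"
    using a by (auto simp: Blk_eq[OF J kN(1)] Blk_eq[OF J kN(2)])
  then have rise: "rise ?w a b > 0" by (auto simp: rise_def phiw_Z[OF J])
  have "a < b" using ge[OF a(1)] a b by (auto simp: b_def order.strict_iff_order)
  have "a \<in> Blk J (Suc k)" using a sub by auto
  have strict: "Num ?w J p k < Dn ?w J p (Suc k)"
    by (rule Num_le_Dn_Suc(2)[OF J k _ a(1) b(1)])
      (use mono[OF k] id[OF b(1)] id[OF \<open>a \<in> Blk J (Suc k)\<close>] \<open>a < b\<close> rise in \<open>auto simp: b_def\<close>)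
  have "Num ?w J p k \<le> Dn ?w J p (Suc k)" if "k \<in> {1..<?N}" for k
    by (rule Num_le_Dn_Suc(1)[OF J that]) (rule mono[OF that])
  then have "(\<Sum>k\<in>{1..<?N}. Num ?w J p k) < (\<Sum>k\<in>{1..<?N}. Dn ?w J p (Suc k))"
    using strict k by (intro sum_strict_mono_ex1) auto
  \<comment> \<open>Telescoping from level \<open>1\<close> to the top. The remaining
    \<open>Dn\<close> at level \<open>1\<close> is nonnegative, and for integers the strict
    inequality gives the \<open>- 1\<close>.\<close>
  also have "\<dots> = (\<Sum>k\<in>{1..<?N}. Dn ?w J p k) + (Dn ?w J p ?N - Dn ?w J p 1)"
    using sum_Suc_diff'[of 1 ?N "Dn ?w J p"] k by (simp add: sum_subtractf)
  also have "Dn ?w J p ?N = mdeg n J" by (rule Dn_top[OF J]) (rule top)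
  finally have "(\<Sum>k\<in>{1..<?N}. Num ?w J p k)
    < (\<Sum>k\<in>{1..<?N}. Dn ?w J p k) + (mdeg n J - Dn ?w J p 1)" .
  moreover have "0 \<le> Dn ?w J p 1"
    unfolding Dn_def by (intro sum_nonneg rise_nonneg)
  ultimately show ?thesis by linarith
qed

lemma Wval_lpoly_small:
  assumes n: "sum_list lam = n" and I: "I \<in> Ilam lam n" and J: "J \<in> Ilam lam n" and "J \<noteq> I"
    and ev: "\<And>x. gen (Z ` {1..n}) x \<Longrightarrow> evalp x f = Wval lam I J 0 (\<lambda>a. x (Z a))"
  shows "Jsmall J f"
  unfolding Jsmall_iff_degle[OF J]
proof
  note f = Wval_lpoly_mult_Opol[OF I J ev]
  show "degle (phiw J) (mdeg n J - 1) f"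
  proof (rule Wval_lpoly_degle[OF I J f])
    fix \<sigma> assume \<sigma>: "\<sigma> \<in> symperms lam" and nz: "Tpol lam J (pp lam I J \<sigma>) \<noteq> 0"
    show "(\<Sum>k\<in>{1..<length lam}. Num (phiw J) J (pp lam I J \<sigma>) k)
      \<le> (\<Sum>k\<in>{1..<length lam}. Dn (phiw J) J (pp lam I J \<sigma>) k) + (mdeg n J - 1)"
      by (rule Num_le_Dn_upper[OF J I \<open>J \<noteq> I\<close>])
        (use Tpol_nonzero_mono[OF J nz] bij_betw_pp[OF I J \<sigma>] pp_top[OF n I J \<sigma>] in auto)
  qed
  show "degle (\<lambda>v. - phiw J v) 0 f"
  proof (rule Wval_lpoly_degle[OF I J f])
    fix \<sigma> assume \<sigma>: "\<sigma> \<in> symperms lam" and nz: "Tpol lam J (pp lam I J \<sigma>) \<noteq> 0"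
    show "(\<Sum>k\<in>{1..<length lam}. Num (\<lambda>v. - phiw J v) J (pp lam I J \<sigma>) k)
      \<le> (\<Sum>k\<in>{1..<length lam}. Dn (\<lambda>v. - phiw J v) J (pp lam I J \<sigma>) k) + 0"
      unfolding add_0_right
      by (rule sum_mono, rule Num_le_Dn_lower[OF J]) (use Tpol_nonzero_mono[OF J nz] in auto)
  qed
qed

section \<open>The restriction to \<open>x_I\<close> itself\<close>

lemma Tpol_diag_nonzero_imp_id:
  assumes n: "sum_list lam = n" and I: "I \<in> Ilam lam n" and \<sigma>: "\<sigma> \<in> symperms lam"
    and nz: "Tpol lam I (pp lam I I \<sigma>) \<noteq> 0"
  shows "\<sigma> = (\<lambda>_. id)"
proof
  fix k
  let ?N = "length lam" and ?p = "pp lam I I \<sigma>"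
  show "\<sigma> k = id"
  proof (cases "k \<in> {1..<?N}")
    case False
    then show ?thesis using \<sigma> by (simp add: symperms_def)
  next
    case True
    \<comment> \<open>Downward induction from the top level, where the map is the identity; a
      bijection of \<open>Blk I k\<close> that moves nothing down is then the identity.\<close>
    have ge: "\<forall>a\<in>Blk I k. a \<le> ?p k a" if "1 \<le> k" "k \<le> ?N" for k
      using that(2,1)
    proof (induction k rule: inc_induct)
      case base
      then show ?case using pp_top[OF n I I \<sigma>] by (simp add: Blk_top[OF I])
    next
      case (step k)
      show ?case
      proof
        fix a assume a: "a \<in> Blk I k"
        have "a \<in> Blk I (Suc k)" using a Blk_Suc[OF I, of k] step.hyps by auto
        then have "a \<le> ?p (Suc k) a" using step.IH by simp
        also have "\<dots> \<le> ?p k a" by (rule Tpol_nonzero_mono[OF I nz _ a]) (use step in auto)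
        finally show "a \<le> ?p k a" .
      qed
    qed
    have kN: "k \<le> ?N" using True by simp
    have "\<sigma> k a = a" if a: "a < lev lam k" for a
    proof -
      have q: "qq I \<sigma> k a \<in> Blk I k" using bij_betwE[OF bij_betw_qq[OF I \<sigma> kN]] a by simp
      have "?p k (qq I \<sigma> k a) = qq I \<sigma> k a"
        by (rule increasing_bij_id[OF finite_Blk[OF I kN] bij_betw_pp[OF I I \<sigma> kN]])
          (use ge True q in auto)
      then have "idx I k (\<sigma> k a) = idx I k a" using pp_qq[OF I \<sigma> kN a, of I] by (simp add: qq_def)
      then show ?thesis
        using inj_onD[OF bij_betw_imp_inj_on[OF bij_betw_idx[OF I kN]]] symperms_less[OF \<sigma> a] a by simp
    qed
    moreover have "\<sigma> k a = a" if "\<not> a < lev lam k" for a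
      using permutes_not_in[OF symperms_permutes[OF \<sigma>]] that by simp
    ultimately show ?thesis by (auto simp: fun_eq_iff)
  qed
qed

text \<open>The pairs \<open>a < b\<close> inside \<open>Blk I k\<close> complete the pairs
  \<open>b < a\<close> to all factors of \<open>Opol\<close>; the remaining pairs have
  \<open>b\<close> in the added block \<open>I ! k\<close> and make up
  \<open>Pdiag I\<close>.\<close>

lemma Tpol_id:
  assumes I: "I \<in> Ilam lam n"
    and p: "\<And>k a. k \<le> length lam \<Longrightarrow> a \<in> Blk I k \<Longrightarrow> p k a = a"
  shows "Tpol lam I p = Pdiag I * Opol lam I"
proof -
  let ?K = "{1..<length lam}"
  have "Tpol lam I p = (\<Prod>k\<in>?K. \<Prod>a\<in>Blk I k. (\<Prod>b\<in>{b\<in>I!k. a < b}. lin (Z a) (Z b))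
      * (\<Prod>b\<in>Blk I k - {a}. lin (Z a) (Z b)))"
    unfolding Tpol_def
  proof (intro prod.cong refl)
    fix k a assume k: "k \<in> ?K" and a: "a \<in> Blk I k"
    have fin: "finite (Blk I k)" "finite (I!k)" using finite_Blk[OF I] Ilam_finite[OF I] k by auto
    have S: "Blk I (Suc k) = Blk I k \<union> I!k" "Blk I k \<inter> I!k = {}" using Blk_Suc[OF I] k by auto
    have "{b\<in>Blk I (Suc k). p k a < p (Suc k) b} = {b\<in>I!k. a < b} \<union> {b\<in>Blk I k. a < b}"
      using S(1) p[of k] p[of "Suc k"] k a by auto
    then have 1: "(\<Prod>b\<in>{b\<in>Blk I (Suc k). p k a < p (Suc k) b}. lin (Z a) (Z b))
      = (\<Prod>b\<in>{b\<in>I!k. a < b}. lin (Z a) (Z b)) * (\<Prod>b\<in>{b\<in>Blk I k. a < b}. lin (Z a) (Z b))"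
      using prod.union_disjoint[of "{b\<in>I!k. a < b}" "{b\<in>Blk I k. a < b}" "\<lambda>b. lin (Z a) (Z b)"] fin S(2) by auto
    have 2: "{b\<in>Blk I k. p k b < p k a} = {b\<in>Blk I k. b < a}" using p[of k] k a by auto
    have 3: "Blk I k - {a} = {b\<in>Blk I k. a < b} \<union> {b\<in>Blk I k. b < a}" by auto
    have "(\<Prod>b\<in>Blk I k - {a}. lin (Z a) (Z b))
      = (\<Prod>b\<in>{b\<in>Blk I k. a < b}. lin (Z a) (Z b)) * (\<Prod>b\<in>{b\<in>Blk I k. b < a}. lin (Z a) (Z b))"
      unfolding 3 by (rule prod.union_disjoint) (use fin in auto)
    with 1 2 show "(\<Prod>b\<in>{b\<in>Blk I (Suc k). p k a < p (Suc k) b}. lin (Z a) (Z b))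
        * (\<Prod>b\<in>{b\<in>Blk I k. p k b < p k a}. lin (Z a) (Z b))
      = (\<Prod>b\<in>{b\<in>I!k. a < b}. lin (Z a) (Z b)) * (\<Prod>b\<in>Blk I k - {a}. lin (Z a) (Z b))"
      by (simp only: mult.assoc)
  qed
  also have "\<dots> = (\<Prod>k\<in>?K. \<Prod>a\<in>Blk I k. \<Prod>b\<in>{b\<in>I!k. a < b}. lin (Z a) (Z b)) * Opol lam I"
    by (simp add: Opol_def prod.distrib)
  also have "(\<Prod>k\<in>?K. \<Prod>a\<in>Blk I k. \<Prod>b\<in>{b\<in>I!k. a < b}. lin (Z a) (Z b)) = Pdiag I"
  proof -
    let ?S = "SIGMA k:?K. SIGMA a:Blk I k. {b\<in>I!k. a < b}"
    have "(\<Prod>k\<in>?K. \<Prod>a\<in>Blk I k. \<Prod>b\<in>{b\<in>I!k. a < b}. lin (Z a) (Z b))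
      = (\<Prod>k\<in>?K. \<Prod>(a, b)\<in>(SIGMA a:Blk I k. {b\<in>I!k. a < b}). lin (Z a) (Z b))"
      using Ilam_finite[OF I] finite_Blk[OF I] by (intro prod.cong prod.Sigma refl) auto
    also have "\<dots> = (\<Prod>(k, a, b)\<in>?S. lin (Z a) (Z b))"
      using Ilam_finite[OF I] finite_Blk[OF I] by (intro prod.Sigma) auto
    also have "\<dots> = (\<Prod>(a, b)\<in>noninv n I. lin (Z a) (Z b))"
    \<comment> \<open>A pair occurs at exactly one level, the number of the block of
      \<open>b\<close> counted from 0; it is at least \<open>1\<close> because \<open>a\<close> lies
      in an earlier block.\<close>
    proof (rule prod.reindex_bij_witness[of _ "\<lambda>(a, b). (blk I b, a, b)" "\<lambda>(k, a, b). (a, b)"])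
      fix q assume "q \<in> ?S"
      then show "(case case q of (k, a, b) \<Rightarrow> (a, b) of (a, b) \<Rightarrow> (blk I b, a, b)) = q"
        "(case q of (k, a, b) \<Rightarrow> (a, b)) \<in> noninv n I"
        "(case case q of (k, a, b) \<Rightarrow> (a, b) of (a, b) \<Rightarrow> lin (Z a) (Z b)) = (case q of (k, a, b) \<Rightarrow> lin (Z a) (Z b))"
        by (auto simp: noninv_def mem_block_iff[OF I] Blk_eq[OF I])
    next
      fix q assume "q \<in> noninv n I"
      then show "(case case q of (a, b) \<Rightarrow> (blk I b, a, b) of (k, a, b) \<Rightarrow> (a, b)) = q"
        "(case q of (a, b) \<Rightarrow> (blk I b, a, b)) \<in> ?S"
        using blk_props[OF I] by (auto simp: noninv_def Blk_eq[OF I] less_imp_le)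
    qed
    finally show ?thesis by (simp add: Pdiag_eq[OF I])
  qed
  finally show ?thesis .
qed

lemma Wval_lpoly_diag:
  assumes n: "sum_list lam = n" and I: "I \<in> Ilam lam n"
    and ev: "\<And>x. gen (Z ` {1..n}) x \<Longrightarrow> evalp x f = Wval lam I I 0 (\<lambda>a. x (Z a))"
  shows "f = Pdiag I"
proof -
  let ?id = "\<lambda>_. id :: nat \<Rightarrow> nat"
  have id: "?id \<in> symperms lam" by (simp add: symperms_def permutes_id)
  have "f * Opol lam I = (\<Sum>\<sigma>\<in>symperms lam. Tpol lam I (pp lam I I \<sigma>))"
    by (rule Wval_lpoly_mult_Opol[OF I I ev])
  also have "\<dots> = (\<Sum>\<sigma>\<in>{?id}. Tpol lam I (pp lam I I \<sigma>))"
    by (rule sum.mono_neutral_right[OF finite_symperms])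
      (use id Tpol_diag_nonzero_imp_id[OF n I] in auto)
  also have "\<dots> = Tpol lam I (pp lam I I ?id)" by (simp add: id_def)
  also have "\<dots> = Pdiag I * Opol lam I"
  proof (rule Tpol_id[OF I])
    fix k a assume k: "k \<le> length lam" and a: "a \<in> Blk I k"
    then obtain c where "c < lev lam k" "a = idx I k c"
      using bij_betw_imp_surj_on[OF bij_betw_idx[OF I k]] by auto
    then show "pp lam I I ?id k a = a" using pp_qq[OF I id k, of c I] by (simp add: qq_def)
  qed
  finally have "f * Opol lam I = Pdiag I * Opol lam I" .
  \<comment> \<open>Having a top degree entails being nonzero; weight \<open>0\<close> suffices for
    this.\<close>
  moreover have "Opol lam I \<noteq> 0"
    using topdeg_Opol[of "\<lambda>_. 0" lam I] by (auto simp: topdeg_def)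
  ultimately show ?thesis by simp
qed

theorem theoremA2p1:
  fixes lam :: "nat list" and n :: nat and I :: "nat set list"
  assumes "sum_list lam = n"
    and "I \<in> Ilam lam n"
  shows "(\<exists>!c. c \<in> Kclass lam n \<and> c I = Pdiag I
              \<and> (\<forall>J\<in>Ilam lam n. J \<noteq> I \<longrightarrow> Jsmall J (c J)))
       \<and> (let w = (\<lambda>J. if J \<in> Ilam lam n then Wres lam n I J else 0) in
            w \<in> Kclass lam n \<and> w I = Pdiag I
              \<and> (\<forall>J\<in>Ilam lam n. J \<noteq> I \<longrightarrow> Jsmall J (w J)))"
proof -
  obtain F where F: "symGZ lam n F"
    and ev: "\<And>J x. J \<in> Ilam lam n \<Longrightarrow> gen (Z ` {1..n}) x \<Longrightarrow>
      evalp x (restr J F) = Wval lam I J 0 (\<lambda>a. x (Z a))"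
    using restr_lpoly[OF assms(1), of I] by blast
  define w where "w = (\<lambda>J. if J \<in> Ilam lam n then Wres lam n I J else 0)"
  have w: "w J = restr J F" if "J \<in> Ilam lam n" for J
    using Wres_eq[OF assms(1) that vars_restr[OF F that] ev[OF that]] that by (simp add: w_def)
  have wK: "w \<in> Kclass lam n"
    unfolding Kclass_def mem_Collect_eq using F w by (intro exI[of _ F]) (simp add: w_def)
  have wI: "w I = Pdiag I"
    using Wval_lpoly_diag[OF assms ev[OF assms(2)]] w[OF assms(2)] by simp
  have wJ: "Jsmall J (w J)" if "J \<in> Ilam lam n" "J \<noteq> I" for J
    using Wval_lpoly_small[OF assms that ev[OF that(1)]] w[OF that(1)] by simp
  have "c = w" if c: "c \<in> Kclass lam n" "c I = Pdiag I"
    "\<forall>J\<in>Ilam lam n. J \<noteq> I \<longrightarrow> Jsmall J (c J)" for c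
  proof -
    from c(1) obtain F' where F': "symGZ lam n F'"
      "\<And>J. c J = (if J \<in> Ilam lam n then restr J F' else 0)"
      unfolding Kclass_def by blast
    have "restr J F' = restr J F" if J: "J \<in> Ilam lam n" for J
    proof (rule restr_unique[OF F'(1) F _ J])
      fix J assume J: "J \<in> Ilam lam n"
      show "degle (phiw J) (mdeg n J - 1) (restr J F' - restr J F)
          \<and> degle (\<lambda>v. - phiw J v) 0 (restr J F' - restr J F)"
      proof (cases "J = I")
        case True
        then have "restr J F' = restr J F"
          using c(2) wI w[OF J] F'(2)[of J] J by simp
        then show ?thesis by simp
      next
        case False
        then have "Jsmall J (restr J F')" "Jsmall J (restr J F)"
          using c(3) wJ[OF J] w[OF J] F'(2)[of J] J by auto
        then show ?thesis unfolding Jsmall_iff_degle[OF J] by (auto intro: degle_diff)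
      qed
    qed
    \<comment> \<open>Outside \<open>Ilam lam n\<close> both families are \<open>0\<close> by
      convention.\<close>
    then show "c = w" using F'(2) w by (auto simp: w_def fun_eq_iff)
  qed
  then have "\<exists>!c. c \<in> Kclass lam n \<and> c I = Pdiag I \<and> (\<forall>J\<in>Ilam lam n. J \<noteq> I \<longrightarrow> Jsmall J (c J))"
    using wK wI wJ by blast
  then show ?thesis
    using wK wI wJ by (simp add: w_def[symmetric] Let_def)
qed

end
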